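(* Let $(V,\omega)$ be a real symplectic vector space of dimension $2n$ with induced contact structure $\xi$ on $\mathbb{P}V$, and let $J:V\to V$ be an $\omega$-compatible complex structure, $J^*\omega=\omega$, with associated inner product $g_J(u,v)=\omega(u,Jv)$. Let $\Sigma\subset\mathbb{P}V$ be a table. Then the following are equivalent: 1. the angle reflection rule over $\Sigma$ with respect to the inner product $g_J$ generates a contact transformation of $(\mathbb{P}V,\xi)$; 2. the angle reflection rule over $\Sigma$ with respect to $g_J$ coincides with the outer contact billiard reflection rule over $\Sigma$; 3. $\Sigma$ is a Hopf table, that is, $\Sigma=\pi_J^{-1}(\Gamma)$ for some hypersurface $\Gamma\subset\mathbb{CP}^{n-1}$, where $\pi_J$ is the Hopf map to $\mathbb{P}_{\mathbb{C}}V\cong\mathbb{CP}^{n-1}$ associated to the complex structure $J$ on $V\cong\mathbb{C}^n$.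
   Context: $\mathbb{P}V$ is the space of real lines through the origin in $V$; $W^\omega$ denotes the $\omega$-orthogonal complement of a subspace $W$. The contact structure is $\xi_q=q^\omega$. A table is a regular hypersurface $\Sigma\subset\mathbb{P}V$; for $q\in\Sigma$ put $q'=(T_q\Sigma)^\omega$, with $T_q\Sigma$ the projective tangent hyperplane viewed as a hyperplane of $V$. When $q'\ne q$ the characteristic line at $q$ is the projective line through $q$ and $q'$ (a 2-plane in $V$). Outer contact billiard reflection rule over $\Sigma$: $Z,Z'$ on the characteristic line at $q\in\Sigma$ correspond if they are harmonic conjugates with respect to $q,q'$ (there are lifts with $\mathbf Z=\mathbf q+\mathbf q'$, $\mathbf Z'=\mathbf q-\mathbf q'$). Angle reflection rule over $\Sigma$ with respect to $g_J$: $Z,Z'$ on the characteristic line at $q\in\Sigma$ correspond if, in the 2-plane of $V$ representing this line, $Z'$ is the $g_J$-reflection of the line $Z$ across the line $q$ (so the angles $\angle(q,Z)$ and $\angle(q,Z')$ are equal, on opposite sides of $q$). A rule generates a contact transformation if the maps $Z\mapsto Z'$ it defines preserve $\xi$; here, as throughout, reflection rules are considered where they define local diffeomorphisms. The Hopf map $\pi_J$ sends a nonzero vector (hence also its real line, a point of $\mathbb{P}V$) to the complex line it spans with respect to $J$; $\pi_J^{-1}(\Gamma)$ is regarded as a subset of $\mathbb{P}V$.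
   Formalization: Here n ≥ 2, tables and hypersurfaces are closed smooth embedded submanifolds, and the implications from 1 to 2 and 3 assume that the angle reflection rule defines local diffeomorphisms over a dense set of points of Σ. *)

theory Defs
  imports "HOL-Analysis.Analysis"
begin

section \<open>Smooth functions on open subsets of Euclidean spaces\<close>

primrec Ck_on ::
    "nat \<Rightarrow> 'a::real_normed_vector set \<Rightarrow> ('a \<Rightarrow> 'b::real_normed_vector) \<Rightarrow> bool" where
  "Ck_on 0 S f \<longleftrightarrow> continuous_on S f"
| "Ck_on (Suc k) S f \<longleftrightarrow> (\<forall>x\<in>S. f differentiable (at x)) \<and>
     (\<forall>v. Ck_on k S (\<lambda>x. frechet_derivative f (at x) v))"

text \<open>Used only for open sets.\<close>

definition smooth_on ::
    "'a::real_normed_vector set \<Rightarrow> ('a \<Rightarrow> 'b::real_normed_vector) \<Rightarrow> bool" where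
  "smooth_on S f \<longleftrightarrow> (\<forall>k. Ck_on k S f)"


section \<open>Symplectic linear algebra\<close>

definition symplectic_form :: "('a::euclidean_space \<Rightarrow> 'a \<Rightarrow> real) \<Rightarrow> bool" where
  "symplectic_form \<omega> \<longleftrightarrow>
     bilinear \<omega> \<and> (\<forall>u. \<omega> u u = 0) \<and> (\<forall>u. (\<forall>v. \<omega> u v = 0) \<longrightarrow> u = 0)"

definition symp_perp :: "('a::euclidean_space \<Rightarrow> 'a \<Rightarrow> real) \<Rightarrow> 'a set \<Rightarrow> 'a set" where
  "symp_perp \<omega> W = {u. \<forall>w\<in>W. \<omega> u w = 0}"

text \<open>The last conjunct says that \<open>g_J\<close> below is positive definite; its bilinearity and symmetry
  follow from the other conjuncts for a symplectic form \<open>\<omega>\<close>.\<close>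

definition compatible_complex_structure ::
    "('a::euclidean_space \<Rightarrow> 'a \<Rightarrow> real) \<Rightarrow> ('a \<Rightarrow> 'a) \<Rightarrow> bool" where
  "compatible_complex_structure \<omega> J \<longleftrightarrow>
     linear J \<and> (\<forall>v. J (J v) = - v) \<and> (\<forall>u v. \<omega> (J u) (J v) = \<omega> u v) \<and>
     (\<forall>u. u \<noteq> 0 \<longrightarrow> \<omega> u (J u) > 0)"

definition g_J ::
    "('a::euclidean_space \<Rightarrow> 'a \<Rightarrow> real) \<Rightarrow> ('a \<Rightarrow> 'a) \<Rightarrow> 'a \<Rightarrow> 'a \<Rightarrow> real" where
  "g_J \<omega> J u v = \<omega> u (J v)"


section \<open>Real and complex projective space as quotients of the nonzero vectors\<close>

text \<open>A point of the real projective space is the line \<open>real_line v\<close> of a nonzero \<open>v\<close>, and a point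
  of the complex one is the complex line \<open>complex_line J v\<close>. Both spaces carry the quotient
  topology and the quotient smooth structure, for which \<open>P = real_line\<close> and \<open>P = complex_line J\<close>
  are submersions on the nonzero vectors: a function \<open>f\<close> on an open set is smooth (has nonzero
  differential) iff its pullback \<open>f \<circ> P\<close> is smooth (has nonzero differential).\<close>

definition real_line :: "'a::euclidean_space \<Rightarrow> 'a set" where
  "real_line v = span {v}"

definition complex_line :: "('a::euclidean_space \<Rightarrow> 'a) \<Rightarrow> 'a \<Rightarrow> 'a set" where
  "complex_line J v = span {v, J v}"

definition quot_space :: "('a::euclidean_space \<Rightarrow> 'a set) \<Rightarrow> 'a set set" where
  "quot_space P = P ` (- {0})"

definition cone_over :: "('a::euclidean_space \<Rightarrow> 'a set) \<Rightarrow> 'a set set \<Rightarrow> 'a set" where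
  "cone_over P U = {v. v \<noteq> 0 \<and> P v \<in> U}"

definition quot_open :: "('a::euclidean_space \<Rightarrow> 'a set) \<Rightarrow> 'a set set \<Rightarrow> bool" where
  "quot_open P U \<longleftrightarrow> U \<subseteq> quot_space P \<and> open (cone_over P U)"

definition local_equation ::
    "('a::euclidean_space \<Rightarrow> 'a set) \<Rightarrow> 'a set set \<Rightarrow> 'a set set \<Rightarrow> ('a set \<Rightarrow> real) \<Rightarrow> bool" where
  "local_equation P S U f \<longleftrightarrow>
     quot_open P U \<and> smooth_on (cone_over P U) (\<lambda>v. f (P v)) \<and>
     (\<forall>p\<in>U. p \<in> S \<longleftrightarrow> f p = 0) \<and>
     (\<forall>v\<in>cone_over P (S \<inter> U). \<exists>w. frechet_derivative (\<lambda>x. f (P x)) (at v) w \<noteq> 0)"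

text \<open>A hypersurface is a closed embedded smooth submanifold of real codimension one. Without
  closedness a proper open piece of a Hopf table would have all the infinitesimal properties of a
  Hopf table without being a full preimage under the Hopf map.\<close>

definition hypersurface :: "('a::euclidean_space \<Rightarrow> 'a set) \<Rightarrow> 'a set set \<Rightarrow> bool" where
  "hypersurface P S \<longleftrightarrow>
     S \<subseteq> quot_space P \<and> quot_open P (quot_space P - S) \<and>
     (\<forall>p\<in>S. \<exists>U f. p \<in> U \<and> local_equation P S U f)"

definition table :: "'a::euclidean_space set set \<Rightarrow> bool" where
  "table \<Sigma> \<longleftrightarrow> hypersurface real_line \<Sigma>"

text \<open>For \<open>q \<in> \<Sigma>\<close> the kernel of the differential of the pulled back local equation at a nonzero
  \<open>v \<in> q\<close> depends neither on \<open>v\<close> nor on the equation. It is a hyperplane of the vector space and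
  contains \<open>q\<close>.\<close>

definition tangent_hyperplane :: "'a::euclidean_space set set \<Rightarrow> 'a set \<Rightarrow> 'a set" where
  "tangent_hyperplane \<Sigma> q =
     {w. \<forall>U f. \<forall>v\<in>q - {0}. q \<in> U \<and> local_equation real_line \<Sigma> U f \<longrightarrow>
           frechet_derivative (\<lambda>x. f (real_line x)) (at v) w = 0}"


section \<open>Smooth maps and contact transformations of the real projective space\<close>

definition local_lift ::
    "('a::euclidean_space set \<Rightarrow> 'a set) \<Rightarrow> 'a set set \<Rightarrow> 'a set \<Rightarrow> ('a \<Rightarrow> 'a) \<Rightarrow> bool" where
  "local_lift \<phi> U N F \<longleftrightarrow>
     open N \<and> N \<subseteq> cone_over real_line U \<and> smooth_on N F \<and>
     (\<forall>x\<in>N. F x \<noteq> 0 \<and> \<phi> (real_line x) = real_line (F x))"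

definition proj_smooth_on ::
    "'a::euclidean_space set set \<Rightarrow> ('a set \<Rightarrow> 'a set) \<Rightarrow> bool" where
  "proj_smooth_on U \<phi> \<longleftrightarrow> (\<forall>v\<in>cone_over real_line U. \<exists>N F. v \<in> N \<and> local_lift \<phi> U N F)"

definition proj_diffeo_on ::
    "'a::euclidean_space set set \<Rightarrow> ('a set \<Rightarrow> 'a set) \<Rightarrow> bool" where
  "proj_diffeo_on U \<phi> \<longleftrightarrow>
     quot_open real_line U \<and> quot_open real_line (\<phi> ` U) \<and> proj_smooth_on U \<phi> \<and>
     (\<exists>\<psi>. proj_smooth_on (\<phi> ` U) \<psi> \<and> (\<forall>Z\<in>U. \<psi> (\<phi> Z) = Z))"

definition contact_hyperplane ::
    "('a::euclidean_space \<Rightarrow> 'a \<Rightarrow> real) \<Rightarrow> 'a set \<Rightarrow> 'a set" where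
  "contact_hyperplane \<omega> q = symp_perp \<omega> q"

text \<open>The tangent space of the projective space at \<open>real_line v\<close> is represented by vectors
  modulo \<open>real_line v\<close>, through the differential of \<open>real_line\<close> at \<open>v\<close>. In this representation
  the differential of \<open>\<phi>\<close> is the differential of a lift \<open>F\<close>, and hyperplanes of the tangent space
  correspond to hyperplanes of the vector space containing \<open>real_line v\<close>. For a local
  diffeomorphism the condition says that the differential of \<open>\<phi>\<close> maps the contact hyperplane onto
  the contact hyperplane.\<close>

definition preserves_contact ::
    "('a::euclidean_space \<Rightarrow> 'a \<Rightarrow> real) \<Rightarrow> 'a set set \<Rightarrow> ('a set \<Rightarrow> 'a set) \<Rightarrow> bool" where
  "preserves_contact \<omega> U \<phi> \<longleftrightarrow>
     (\<forall>N F. local_lift \<phi> U N F \<longrightarrow>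
       (\<forall>v\<in>N. \<forall>w. w \<in> contact_hyperplane \<omega> (real_line v) \<longleftrightarrow>
          frechet_derivative F (at v) w \<in> contact_hyperplane \<omega> (\<phi> (real_line v))))"


section \<open>Reflection rules\<close>

definition polar_point ::
    "('a::euclidean_space \<Rightarrow> 'a \<Rightarrow> real) \<Rightarrow> 'a set set \<Rightarrow> 'a set \<Rightarrow> 'a set" where
  "polar_point \<omega> \<Sigma> q = symp_perp \<omega> (tangent_hyperplane \<Sigma> q)"

definition characteristic_line ::
    "('a::euclidean_space \<Rightarrow> 'a \<Rightarrow> real) \<Rightarrow> 'a set set \<Rightarrow> 'a set \<Rightarrow> 'a set" where
  "characteristic_line \<omega> \<Sigma> q = span (q \<union> polar_point \<omega> \<Sigma> q)"

text \<open>A rule is a relation \<open>R q Z Z'\<close>: the points \<open>Z\<close> and \<open>Z'\<close> of the characteristic line at \<open>q\<close>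
  correspond.

  In the outer rule one of the lifts \<open>a\<close>, \<open>b\<close> may vanish. The correspondence is thus the full
  harmonic involution of the characteristic line, with fixed points \<open>q\<close> and \<open>q'\<close>.\<close>

definition outer_rule ::
    "('a::euclidean_space \<Rightarrow> 'a \<Rightarrow> real) \<Rightarrow> 'a set set \<Rightarrow> 'a set \<Rightarrow> 'a set \<Rightarrow> 'a set \<Rightarrow> bool" where
  "outer_rule \<omega> \<Sigma> q Z Z' \<longleftrightarrow>
     q \<in> \<Sigma> \<and> polar_point \<omega> \<Sigma> q \<noteq> q \<and>
     (\<exists>a\<in>q. \<exists>b\<in>polar_point \<omega> \<Sigma> q. a + b \<noteq> 0 \<and> Z = real_line (a + b) \<and> Z' = real_line (a - b))"

text \<open>On a 2-plane containing \<open>a\<close>, this is the \<open>g\<close>-orthogonal reflection across the line of \<open>a\<close>.\<close>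

definition line_reflection ::
    "('a::euclidean_space \<Rightarrow> 'a \<Rightarrow> real) \<Rightarrow> 'a \<Rightarrow> 'a \<Rightarrow> 'a" where
  "line_reflection g a z = (2 * g z a / g a a) *\<^sub>R a - z"

definition angle_rule ::
    "('a::euclidean_space \<Rightarrow> 'a \<Rightarrow> real) \<Rightarrow> ('a \<Rightarrow> 'a \<Rightarrow> real) \<Rightarrow> 'a set set \<Rightarrow>
       'a set \<Rightarrow> 'a set \<Rightarrow> 'a set \<Rightarrow> bool" where
  "angle_rule \<omega> g \<Sigma> q Z Z' \<longleftrightarrow>
     q \<in> \<Sigma> \<and> polar_point \<omega> \<Sigma> q \<noteq> q \<and>
     (\<exists>a\<in>q - {0}. \<exists>z\<in>characteristic_line \<omega> \<Sigma> q - {0}.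
        Z = real_line z \<and> Z' = real_line (line_reflection g a z))"

definition rules_coincide ::
    "('a set \<Rightarrow> 'a set \<Rightarrow> 'a set \<Rightarrow> bool) \<Rightarrow> ('a set \<Rightarrow> 'a set \<Rightarrow> 'a set \<Rightarrow> bool) \<Rightarrow> bool" where
  "rules_coincide R R' \<longleftrightarrow> (\<forall>q Z Z'. R q Z Z' \<longleftrightarrow> R' q Z Z')"

text \<open>A point \<open>Z\<close> may lie on several characteristic lines, so a rule is multivalued. A local
  diffeomorphism \<open>\<phi>\<close> defined by the rule comes with a smooth choice \<open>\<kappa> Z\<close> of the point of the
  table whose characteristic line is used at \<open>Z\<close>.\<close>

definition defines_local_diffeo ::
    "('a::euclidean_space set \<Rightarrow> 'a set \<Rightarrow> 'a set \<Rightarrow> bool) \<Rightarrow>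
       'a set set \<Rightarrow> ('a set \<Rightarrow> 'a set) \<Rightarrow> ('a set \<Rightarrow> 'a set) \<Rightarrow> bool" where
  "defines_local_diffeo R U \<kappa> \<phi> \<longleftrightarrow>
     proj_diffeo_on U \<phi> \<and> proj_smooth_on U \<kappa> \<and> (\<forall>Z\<in>U. R (\<kappa> Z) Z (\<phi> Z))"

definition generates_contact_transformation ::
    "('a::euclidean_space \<Rightarrow> 'a \<Rightarrow> real) \<Rightarrow>
       ('a set \<Rightarrow> 'a set \<Rightarrow> 'a set \<Rightarrow> bool) \<Rightarrow> bool" where
  "generates_contact_transformation \<omega> R \<longleftrightarrow>
     (\<forall>U \<kappa> \<phi>. defines_local_diffeo R U \<kappa> \<phi> \<longrightarrow> preserves_contact \<omega> U \<phi>)"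

text \<open>The rule defines local diffeomorphisms over a dense set of points of the table. This fails, for
  instance, if \<open>\<Sigma>\<close> is a projective hyperplane: all characteristic lines then lie in \<open>\<Sigma>\<close>, the rule
  defines no local diffeomorphism, and the previous condition holds vacuously.\<close>

definition defines_local_diffeos_densely ::
    "'a::euclidean_space set set \<Rightarrow> ('a set \<Rightarrow> 'a set \<Rightarrow> 'a set \<Rightarrow> bool) \<Rightarrow> bool" where
  "defines_local_diffeos_densely \<Sigma> R \<longleftrightarrow>
     (\<forall>q\<in>\<Sigma>. \<forall>W. quot_open real_line W \<and> q \<in> W \<longrightarrow>
        (\<exists>U \<kappa> \<phi>. defines_local_diffeo R U \<kappa> \<phi> \<and> (\<exists>Z\<in>U. \<kappa> Z \<in> W)))"


section \<open>Hopf tables\<close>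

definition hopf_map :: "('a::euclidean_space \<Rightarrow> 'a) \<Rightarrow> 'a set \<Rightarrow> 'a set" where
  "hopf_map J L = span (L \<union> J ` L)"

definition hopf_table :: "('a::euclidean_space \<Rightarrow> 'a) \<Rightarrow> 'a set set \<Rightarrow> bool" where
  "hopf_table J \<Sigma> \<longleftrightarrow>
     (\<exists>\<Gamma>. hypersurface (complex_line J) \<Gamma> \<and>
        \<Sigma> = {L \<in> quot_space real_line. hopf_map J L \<in> \<Gamma>})"

end

theory Submission
  imports Defs
begin

text \<open>Over a point \<open>v\<close> of the cone over \<open>\<Sigma>\<close> let \<open>p\<close> span the polar point, so that \<open>\<omega> p\<close> is the differential of a
  local equation. The harmonic involution and the orthogonal reflection of the characteristic line agree
  iff \<open>p\<close> is \<open>g_J\<close>-orthogonal to \<open>v\<close>, that is, iff \<open>J v\<close> is tangent to \<open>\<Sigma>\<close>; where the polar point is the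
  point itself, nothing is required, but such points are nowhere dense, since the contact structure has no
  integral hypersurface. Tangency of \<open>J v\<close> everywhere means that \<open>\<Sigma>\<close> is a union of orbits of the circle
  action, that is, a Hopf table.

  If \<open>x = \<alpha> K + \<beta> p\<close> lies on the characteristic line of the point \<open>K\<close> of the table, which depends smoothly
  on \<open>x\<close>, the reflection is \<open>R = 2 s K - x\<close> with \<open>s = g_J x K / g_J K K\<close>, and
  \<open>\<omega> (dR w) R = \<omega> w x + 4 s (s - \<alpha>) \<omega> (dK w) K\<close>, where \<open>\<alpha> \<omega> (dK w) K = \<omega> w K\<close> and \<open>\<alpha>\<close>, \<open>\<beta>\<close> do not
  vanish. The reflection is therefore contact iff \<open>s = 0\<close> or \<open>s = \<alpha>\<close>. The latter is the orthogonality of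
  \<open>p\<close> and \<open>K\<close>, and the former is impossible on an open set, where it would make the line of \<open>x\<close> a function
  of the line of \<open>K\<close>.\<close>

section \<open>Calculus\<close>

lemma Ck_on_cong:
  assumes "open S" "\<And>x. x \<in> S \<Longrightarrow> f x = g x" "Ck_on k S f"
  shows "Ck_on k S g"
  using assms(2,3)
proof (induction k arbitrary: f g)
  case 0
  then show ?case by (auto cong: continuous_on_cong)
next
  case (Suc k)
  have D: "(g has_derivative frechet_derivative f (at x)) (at x)" if "x \<in> S" for x
    using Suc.prems assms(1) that
    by (auto simp: frechet_derivative_works intro: has_derivative_transform_within_open)
  then have E: "frechet_derivative f (at x) = frechet_derivative g (at x)" if "x \<in> S" for x
    using that frechet_derivative_at by blast
  show ?case
    unfolding Ck_on.simps
  proof (intro conjI ballI allI)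
    show "g differentiable at x" if "x \<in> S" for x
      using D that by (auto simp: differentiable_def)
    show "Ck_on k S (\<lambda>x. frechet_derivative g (at x) v)" for v
      using Suc.IH[of "\<lambda>x. frechet_derivative f (at x) v"] Suc.prems(2) E by simp
  qed
qed

lemma Ck_on_SucI:
  assumes "open S" "\<And>x. x \<in> S \<Longrightarrow> (f has_derivative f' x) (at x)" "\<And>v. Ck_on k S (\<lambda>x. f' x v)"
  shows "Ck_on (Suc k) S f"
  unfolding Ck_on.simps
proof (intro conjI ballI allI)
  show "f differentiable at x" if "x \<in> S" for x
    using assms(2) that by (auto simp: differentiable_def)
  show "Ck_on k S (\<lambda>x. frechet_derivative f (at x) v)" for v
    by (rule Ck_on_cong[OF assms(1) _ assms(3)[of v]]) (metis assms(2) frechet_derivative_at)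
qed

lemma Ck_on_has_derivative:
  "Ck_on (Suc k) S f \<Longrightarrow> x \<in> S \<Longrightarrow> (f has_derivative frechet_derivative f (at x)) (at x)"
  by (simp add: frechet_derivative_works)

lemma Ck_on_SucD: "Ck_on (Suc k) S f \<Longrightarrow> Ck_on k S f"
proof (induction k arbitrary: f)
  case 0
  then show ?case
    by (auto intro!: continuous_at_imp_continuous_on differentiable_imp_continuous_within)
next
  case (Suc k)
  then show ?case by (metis Ck_on.simps(2))
qed

lemma Ck_on_const: "Ck_on k S (\<lambda>x. c)"
  by (induction k arbitrary: c) auto

lemma Ck_on_ident: "Ck_on k S (\<lambda>x. x)"
  by (cases k) (auto simp: Ck_on_const)

lemma Ck_on_add:
  assumes "open S" "Ck_on k S f" "Ck_on k S g"
  shows "Ck_on k S (\<lambda>x. f x + g x)"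
  using assms(2,3)
proof (induction k arbitrary: f g)
  case (Suc k)
  show ?case
  proof (rule Ck_on_SucI[OF assms(1)])
    show "((\<lambda>x. f x + g x) has_derivative (\<lambda>v. frechet_derivative f (at x) v + frechet_derivative g (at x) v)) (at x)"
      if "x \<in> S" for x
      using Suc.prems that by (intro has_derivative_add Ck_on_has_derivative)
    show "Ck_on k S (\<lambda>x. frechet_derivative f (at x) v + frechet_derivative g (at x) v)" for v
      using Suc.prems by (intro Suc.IH) auto
  qed
qed (auto intro: continuous_on_add)

lemma Ck_on_sum:
  assumes "open S" "\<And>i. i \<in> I \<Longrightarrow> Ck_on k S (f i)"
  shows "Ck_on k S (\<lambda>x. \<Sum>i\<in>I. f i x)"
  using assms(2) by (induction I rule: infinite_finite_induct) (auto intro: Ck_on_const Ck_on_add assms)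

lemma Ck_on_bilinear:
  assumes "bounded_bilinear B" "open S" "Ck_on k S f" "Ck_on k S g"
  shows "Ck_on k S (\<lambda>x. B (f x) (g x))"
  using assms(3,4)
proof (induction k arbitrary: f g)
  case 0
  then show ?case using bounded_bilinear.continuous_on[OF assms(1)] by auto
next
  case (Suc k)
  show ?case
  proof (rule Ck_on_SucI[OF assms(2)])
    show "((\<lambda>x. B (f x) (g x)) has_derivative
        (\<lambda>v. B (f x) (frechet_derivative g (at x) v) + B (frechet_derivative f (at x) v) (g x))) (at x)"
      if "x \<in> S" for x
      using Suc.prems that by (intro bounded_bilinear.FDERIV[OF assms(1)] Ck_on_has_derivative)
    have "Ck_on k S f" "Ck_on k S g" using Suc.prems by (auto dest: Ck_on_SucD simp del: Ck_on.simps)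
    then show "Ck_on k S (\<lambda>x. B (f x) (frechet_derivative g (at x) v) + B (frechet_derivative f (at x) v) (g x))" for v
      using Suc.prems by (intro Ck_on_add assms(2) Suc.IH) auto
  qed
qed

lemma Ck_on_bounded_linear:
  assumes "bounded_linear L" "open S" "Ck_on k S f"
  shows "Ck_on k S (\<lambda>x. L (f x))"
  using assms(3)
proof (induction k arbitrary: f)
  case 0
  then show ?case using bounded_linear.continuous_on[OF assms(1)] by auto
next
  case (Suc k)
  show ?case
  proof (rule Ck_on_SucI[OF assms(2)])
    show "((\<lambda>x. L (f x)) has_derivative (\<lambda>v. L (frechet_derivative f (at x) v))) (at x)" if "x \<in> S" for x
      using Suc.prems that by (intro bounded_linear.has_derivative[OF assms(1)] Ck_on_has_derivative)
    show "Ck_on k S (\<lambda>x. L (frechet_derivative f (at x) v))" for v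
      using Suc.prems by (intro Suc.IH) auto
  qed
qed

lemma linear_basis_expansion:
  fixes L :: "'a::euclidean_space \<Rightarrow> 'b::real_normed_vector"
  assumes "linear L"
  shows "L v = (\<Sum>b\<in>Basis. (v \<bullet> b) *\<^sub>R L b)"
proof -
  have "L v = L (\<Sum>b\<in>Basis. (v \<bullet> b) *\<^sub>R b)" by (simp add: euclidean_representation)
  also have "\<dots> = (\<Sum>b\<in>Basis. (v \<bullet> b) *\<^sub>R L b)"
    using assms by (simp add: linear_sum linear_scale)
  finally show ?thesis .
qed

lemma Ck_on_compose:
  fixes f :: "'a::euclidean_space \<Rightarrow> 'b::real_normed_vector" and s :: "'c::real_normed_vector \<Rightarrow> 'a"
  assumes "open S" "open T" "s ` S \<subseteq> T" "Ck_on k S s" "Ck_on k T f"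
  shows "Ck_on k S (\<lambda>x. f (s x))"
  using assms(4,5)
proof (induction k arbitrary: f)
  case 0
  then show ?case using assms(3) by (auto intro: continuous_on_compose2)
next
  case (Suc k)
  have D: "((\<lambda>x. f (s x)) has_derivative (\<lambda>v. frechet_derivative f (at (s x)) (frechet_derivative s (at x) v))) (at x)"
    if "x \<in> S" for x
  proof -
    have "s x \<in> T" using assms(3) that by auto
    then show ?thesis
      using Suc.prems that by (intro has_derivative_compose[of s _ x UNIV f] Ck_on_has_derivative)
  qed
  \<comment> \<open>The chain rule applies the derivative of \<open>f\<close> to a moving vector.
    Expanding that vector in \<open>Basis\<close> leaves partial derivatives of \<open>f\<close> in
    fixed directions, to which the induction hypothesis applies.\<close>
  define g where "g = (\<lambda>x v. \<Sum>b\<in>Basis. (frechet_derivative s (at x) v \<bullet> b) *\<^sub>R frechet_derivative f (at (s x)) b)"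
  have D': "((\<lambda>x. f (s x)) has_derivative g x) (at x)" if "x \<in> S" for x
  proof -
    have "linear (frechet_derivative f (at (s x)))"
      using Suc.prems(2) assms(3) that by (intro linear_frechet_derivative) auto
    then have "g x = (\<lambda>v. frechet_derivative f (at (s x)) (frechet_derivative s (at x) v))"
      unfolding g_def by (intro ext linear_basis_expansion[symmetric])
    then show ?thesis using D[OF that] by simp
  qed
  have "Ck_on k S (\<lambda>x. g x v)" for v
    unfolding g_def
  proof (intro Ck_on_sum assms(1) Ck_on_bilinear[OF bounded_bilinear_scaleR])
    fix b :: 'a
    show "Ck_on k S (\<lambda>x. frechet_derivative s (at x) v \<bullet> b)"
      using Suc.prems by (intro Ck_on_bounded_linear[OF bounded_linear_inner_left] assms(1)) auto
    show "Ck_on k S (\<lambda>x. frechet_derivative f (at (s x)) b)"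
      using Suc.prems Ck_on_SucD by (intro Suc.IH) auto
  qed
  then show ?case using D' by (rule Ck_on_SucI[OF assms(1), rotated])
qed

text \<open>If \<open>G' w\<close> were nonzero, then on a short segment
  \<open>v + t (w + s e)\<close> with \<open>e\<close> transverse to the zero set, the intermediate
  value theorem would give a zero of \<open>F\<close>, hence of \<open>G\<close>. To first order
  \<open>G\<close> is \<open>t (G' w + s G' e)\<close> there, and \<open>s\<close> is kept too small
  for the second term to cancel the first.\<close>

lemma zero_set_derivative:
  fixes F G :: "'a::euclidean_space \<Rightarrow> real"
  assumes F: "(F has_derivative F') (at v)" and G: "(G has_derivative G') (at v)"
    and N: "open N" "v \<in> N" "continuous_on N F"
    and v: "F v = 0" and FG: "\<And>x. x \<in> N \<Longrightarrow> F x = 0 \<Longrightarrow> G x = 0"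
    and u: "F' u \<noteq> 0" and w: "F' w = 0"
  shows "G' w = 0"
proof (rule ccontr)
  assume Gw: "G' w \<noteq> 0"
  have lF: "linear F'" and lG: "linear G'"
    using F G by (auto intro: has_derivative_linear)
  \<comment> \<open>Scaling by \<open>F' u\<close> fixes the sign, since \<open>F' e\<close> is the
    square of \<open>F' u\<close>.\<close>
  define e where "e = F' u *\<^sub>R u"
  have Fe: "F' e > 0" using u by (simp add: e_def linear_scale[OF lF] power2_eq_square[symmetric])
  define \<epsilon> where "\<epsilon> = \<bar>G' w\<bar> / (2 * (\<bar>G' e\<bar> + 1))"
  have \<epsilon>: "\<epsilon> > 0" "\<epsilon> * \<bar>G' e\<bar> \<le> \<bar>G' w\<bar> / 2"
    using Gw by (auto simp: \<epsilon>_def field_simps)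
  define M where "M = norm w + \<epsilon> * norm e + 1"
  have M: "M > 0" using \<epsilon> by (auto simp: M_def add_nonneg_pos)
  \<comment> \<open>\<open>\<eta>\<close> is the relative error of both linearisations. The absolute
    error \<open>t \<eta> M\<close> stays below \<open>t \<epsilon> F' e\<close>, so that
    \<open>F\<close> changes sign, and below half of \<open>t \<bar>G' w\<bar>\<close>.\<close>
  define \<eta> where "\<eta> = min (\<epsilon> * F' e) (\<bar>G' w\<bar> / 2) / (2 * M)"
  have \<eta>: "\<eta> > 0" "\<eta> * M < \<epsilon> * F' e" "\<eta> * M < \<bar>G' w\<bar> / 2"
    using \<epsilon> Fe Gw M by (auto simp: \<eta>_def min_def)
  obtain d1 where d1: "d1 > 0"
    "\<And>y. norm (y - v) < d1 \<Longrightarrow> norm (F y - F v - F' (y - v)) \<le> \<eta> * norm (y - v)"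
    using F \<eta>(1) unfolding has_derivative_at_alt by blast
  obtain d2 where d2: "d2 > 0"
    "\<And>y. norm (y - v) < d2 \<Longrightarrow> norm (G y - G v - G' (y - v)) \<le> \<eta> * norm (y - v)"
    using G \<eta>(1) unfolding has_derivative_at_alt by blast
  obtain d3 where d3: "d3 > 0" "ball v d3 \<subseteq> N" using N by (meson openE)
  define t where "t = min d1 (min d2 d3) / (2 * M)"
  have t: "t > 0" "t * M < d1" "t * M < d2" "t * M < d3"
    using d1 d2 d3 M by (auto simp: t_def min_def)
  define c where "c = (\<lambda>s. v + t *\<^sub>R (w + s *\<^sub>R e))"
  have nc: "norm (w + s *\<^sub>R e) \<le> M" if "\<bar>s\<bar> \<le> \<epsilon>" for s
  proof -
    have "norm (w + s *\<^sub>R e) \<le> norm w + \<bar>s\<bar> * norm e" by (metis norm_triangle_ineq norm_scaleR)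
    then show ?thesis using that by (smt (verit) M_def mult_right_mono norm_ge_zero)
  qed
  have nc': "norm (c s - v) \<le> t * M" if "\<bar>s\<bar> \<le> \<epsilon>" for s
    using nc[OF that] t by (simp add: c_def)
  have cN: "c s \<in> N" if "\<bar>s\<bar> \<le> \<epsilon>" for s
    using nc'[OF that] t d3 by (auto simp: dist_norm norm_minus_commute subset_iff)
  have Fc: "\<bar>F (c s) - t * (s * F' e)\<bar> \<le> t * (\<eta> * M)" if "\<bar>s\<bar> \<le> \<epsilon>" for s
  proof -
    have "F' (c s - v) = t * (s * F' e)"
      by (simp add: c_def linear_scale[OF lF] linear_add[OF lF] w)
    then have "\<bar>F (c s) - t * (s * F' e)\<bar> \<le> \<eta> * norm (c s - v)"
      using d1(2)[of "c s"] nc'[OF that] t v by simp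
    also have "\<dots> \<le> t * (\<eta> * M)"
      using mult_left_mono[OF nc'[OF that], of \<eta>] \<eta>(1) by (simp add: mult_ac)
    finally show ?thesis .
  qed
  have k: "t * (\<eta> * M) < t * (\<epsilon> * F' e)" using \<eta> t by simp
  have "F (c \<epsilon>) \<ge> 0" using Fc[of \<epsilon>] \<epsilon> k by auto
  moreover have "F (c (-\<epsilon>)) \<le> 0" using Fc[of "-\<epsilon>"] \<epsilon> k by auto
  moreover have "continuous_on {-\<epsilon>..\<epsilon>} (\<lambda>s. F (c s))"
    by (rule continuous_on_compose2[OF N(3)])
      (use cN in \<open>auto simp: c_def intro!: continuous_intros\<close>)
  ultimately obtain s where s: "-\<epsilon> \<le> s" "s \<le> \<epsilon>" "F (c s) = 0"
    using IVT'[of "\<lambda>s. F (c s)" "-\<epsilon>" 0 \<epsilon>] \<epsilon> by auto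
  then have s': "\<bar>s\<bar> \<le> \<epsilon>" by auto
  have "G (c s) = 0" "G v = 0" using FG cN[OF s'] s v N by auto
  then have "\<bar>G' (c s - v)\<bar> \<le> \<eta> * norm (c s - v)"
    using d2(2)[of "c s"] nc'[OF s'] t by simp
  also have "\<dots> \<le> t * (\<eta> * M)"
    using mult_left_mono[OF nc'[OF s'], of \<eta>] \<eta>(1) by (simp add: mult_ac)
  also have "G' (c s - v) = t * (G' w + s * G' e)"
    by (simp add: c_def linear_scale[OF lG] linear_add[OF lG])
  finally have "t * \<bar>G' w + s * G' e\<bar> \<le> t * (\<eta> * M)"
    using t by (simp add: abs_mult)
  then have 1: "\<bar>G' w + s * G' e\<bar> < \<bar>G' w\<bar> / 2"
    using t \<eta>(3) by auto
  have "\<bar>s * G' e\<bar> \<le> \<bar>G' w\<bar> / 2"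
    using \<epsilon>(2) mult_right_mono[OF s', of "\<bar>G' e\<bar>"] by (simp add: abs_mult)
  then show False using 1 by linarith
qed

text \<open>The mean value theorem along \<open>u\<close> turns the second difference into
  \<open>t\<close> times an increment of \<open>D y u\<close> between two points that differ by
  \<open>t w\<close>; the derivative \<open>H\<close> evaluates that increment.\<close>

lemma second_difference_bound:
  fixes F :: "'a::real_normed_vector \<Rightarrow> real"
  assumes N: "open N" "x \<in> N" and D: "\<And>y. y \<in> N \<Longrightarrow> (F has_derivative D y) (at y)"
    and H: "((\<lambda>y. D y u) has_derivative H) (at x)" and e: "e > 0"
  shows "\<forall>\<^sub>F t in at_right 0.
    \<bar>F (x + t *\<^sub>R u + t *\<^sub>R w) - F (x + t *\<^sub>R u) - F (x + t *\<^sub>R w) + F x - t\<^sup>2 * H w\<bar> \<le> e * t\<^sup>2"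
proof -
  define M where "M = norm u + norm w + 1"
  have M: "M > 0" by (simp add: M_def add_nonneg_pos)
  have lH: "linear H" using H by (rule has_derivative_linear)
  define \<eta> where "\<eta> = e / (2 * M)"
  have \<eta>: "\<eta> > 0" "2 * \<eta> * M = e" using e M by (auto simp: \<eta>_def)
  obtain d1 where d1: "d1 > 0"
    "\<And>y. norm (y - x) < d1 \<Longrightarrow> norm (D y u - D x u - H (y - x)) \<le> \<eta> * norm (y - x)"
    using H \<eta>(1) unfolding has_derivative_at_alt by blast
  obtain d2 where d2: "d2 > 0" "ball x d2 \<subseteq> N" using N by (meson openE)
  have "\<bar>F (x + t *\<^sub>R u + t *\<^sub>R w) - F (x + t *\<^sub>R u) - F (x + t *\<^sub>R w) + F x - t\<^sup>2 * H w\<bar> \<le> e * t\<^sup>2"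
    if t: "t > 0" "t < min d1 d2 / M" for t
  proof -
    have tM: "t * M < d1" "t * M < d2" using t M by (auto simp: field_simps)
    have nb: "norm (s *\<^sub>R u + r *\<^sub>R w) \<le> t * M" if "0 \<le> s" "s \<le> t" "0 \<le> r" "r \<le> t" for s r
    proof -
      have "norm (s *\<^sub>R u + r *\<^sub>R w) \<le> s * norm u + r * norm w"
        using that by (metis norm_triangle_ineq norm_scaleR abs_of_nonneg)
      also have "\<dots> \<le> t * norm u + t * norm w"
        using that by (intro add_mono mult_right_mono) auto
      finally show ?thesis using t by (simp add: M_def algebra_simps)
    qed
    have inN: "x + s *\<^sub>R u + r *\<^sub>R w \<in> N" if "0 \<le> s" "s \<le> t" "0 \<le> r" "r \<le> t" for s r
    proof -
      have "dist (x + s *\<^sub>R u + r *\<^sub>R w) x < d2" using nb[OF that] tM by (simp add: dist_norm add.assoc)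
      then show ?thesis using d2(2) by (auto simp: dist_commute)
    qed
    have Du: "\<bar>D (x + s *\<^sub>R u + r *\<^sub>R w) u - D x u - H (s *\<^sub>R u + r *\<^sub>R w)\<bar> \<le> \<eta> * (t * M)"
      if "0 \<le> s" "s \<le> t" "0 \<le> r" "r \<le> t" for s r
    proof -
      have "\<bar>D (x + s *\<^sub>R u + r *\<^sub>R w) u - D x u - H (s *\<^sub>R u + r *\<^sub>R w)\<bar> \<le> \<eta> * norm (s *\<^sub>R u + r *\<^sub>R w)"
        using d1(2)[of "x + s *\<^sub>R u + r *\<^sub>R w"] nb[OF that] tM by (simp add: add.assoc)
      also have "\<dots> \<le> \<eta> * (t * M)" using nb[OF that] \<eta> by simp
      finally show ?thesis .
    qed
    define \<phi> where "\<phi> = (\<lambda>s. F (x + s *\<^sub>R u + t *\<^sub>R w) - F (x + s *\<^sub>R u))"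
    have der: "(\<phi> has_real_derivative D (x + s *\<^sub>R u + t *\<^sub>R w) u - D (x + s *\<^sub>R u) u) (at s)"
      if s: "0 \<le> s" "s \<le> t" for s
    proof -
      have c: "((\<lambda>s. F (x + s *\<^sub>R u + r *\<^sub>R w)) has_derivative (\<lambda>h. D (x + s *\<^sub>R u + r *\<^sub>R w) (h *\<^sub>R u))) (at s)"
        if "0 \<le> r" "r \<le> t" for r
        using D[OF inN[OF s that]]
        by (intro has_derivative_compose[of "\<lambda>s. x + s *\<^sub>R u + r *\<^sub>R w" _ s UNIV F])
          (auto intro!: derivative_eq_intros)
      have l: "D (x + s *\<^sub>R u + r *\<^sub>R w) (h *\<^sub>R u) = D (x + s *\<^sub>R u + r *\<^sub>R w) u * h" if "0 \<le> r" "r \<le> t" for r h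
        using linear_scale[OF has_derivative_linear[OF D[OF inN[OF s that]]]] by simp
      have eq: "(*) (a - b) = (\<lambda>h. a * h - b * h)" for a b :: real
        by (simp add: fun_eq_iff left_diff_distrib)
      show ?thesis
        unfolding has_field_derivative_def \<phi>_def eq
        using has_derivative_eq_rhs[OF has_derivative_diff[OF c[of t] c[of 0]], of
            "\<lambda>h. (D (x + s *\<^sub>R u + t *\<^sub>R w) u - D (x + s *\<^sub>R u + 0 *\<^sub>R w) u) * h"] t l[of t] l[of 0]
        by (simp add: left_diff_distrib)
    qed
    obtain z where z: "0 < z" "z < t"
      "\<phi> t - \<phi> 0 = t * (D (x + z *\<^sub>R u + t *\<^sub>R w) u - D (x + z *\<^sub>R u) u)"
      using MVT2[of 0 t \<phi> "\<lambda>s. D (x + s *\<^sub>R u + t *\<^sub>R w) u - D (x + s *\<^sub>R u) u"] der t by auto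
    have "H (z *\<^sub>R u + t *\<^sub>R w) - H (z *\<^sub>R u) = t * H w"
      by (simp add: linear_add[OF lH] linear_scale[OF lH])
    then have b: "\<bar>D (x + z *\<^sub>R u + t *\<^sub>R w) u - D (x + z *\<^sub>R u) u - t * H w\<bar> \<le> 2 * \<eta> * M * t"
      using Du[of z t] Du[of z 0] z t by (simp add: algebra_simps)
    have "F (x + t *\<^sub>R u + t *\<^sub>R w) - F (x + t *\<^sub>R u) - F (x + t *\<^sub>R w) + F x = \<phi> t - \<phi> 0"
      by (simp add: \<phi>_def)
    then have "F (x + t *\<^sub>R u + t *\<^sub>R w) - F (x + t *\<^sub>R u) - F (x + t *\<^sub>R w) + F x - t\<^sup>2 * H w
      = t * (D (x + z *\<^sub>R u + t *\<^sub>R w) u - D (x + z *\<^sub>R u) u - t * H w)"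
      unfolding z(3) by (simp add: power2_eq_square algebra_simps)
    then have "\<bar>F (x + t *\<^sub>R u + t *\<^sub>R w) - F (x + t *\<^sub>R u) - F (x + t *\<^sub>R w) + F x - t\<^sup>2 * H w\<bar>
      = t * \<bar>D (x + z *\<^sub>R u + t *\<^sub>R w) u - D (x + z *\<^sub>R u) u - t * H w\<bar>"
      using t by (simp add: abs_mult)
    also have "\<dots> \<le> t * (2 * \<eta> * M * t)"
      using mult_left_mono[OF b, of t] t by simp
    also have "\<dots> = e * t\<^sup>2" using \<eta>(2) by (simp add: power2_eq_square)
    finally show ?thesis .
  qed
  then show ?thesis
    unfolding eventually_at_right_field using d1 d2 M by (intro exI[of _ "min d1 d2 / M"]) auto
qed

text \<open>The second difference is symmetric in \<open>u\<close> and \<open>w\<close>, so for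
  small \<open>t\<close> the numbers \<open>t\<^sup>2 * Hu w\<close> and
  \<open>t\<^sup>2 * Hw u\<close> differ by at most \<open>2 * e * t\<^sup>2\<close>. Taking a third
  of the gap for \<open>e\<close> contradicts this.\<close>

lemma second_derivative_symmetric:
  fixes F :: "'a::real_normed_vector \<Rightarrow> real"
  assumes "open N" "x \<in> N" and "\<And>y. y \<in> N \<Longrightarrow> (F has_derivative D y) (at y)"
    and "((\<lambda>y. D y u) has_derivative Hu) (at x)" and "((\<lambda>y. D y w) has_derivative Hw) (at x)"
  shows "Hu w = Hw u"
proof (rule ccontr)
  assume ne: "Hu w \<noteq> Hw u"
  define e where "e = \<bar>Hu w - Hw u\<bar> / 3"
  have e: "e > 0" using ne by (simp add: e_def)
  note bound = second_difference_bound[OF assms(1,2) _ _ e]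
  have "\<forall>\<^sub>F t in at_right (0::real). False"
    using bound[OF assms(3,4), of w, simplified] bound[OF assms(3,5), of u, simplified]
      eventually_at_right_less[of 0]
  proof eventually_elim
    case (elim t)
    have "\<bar>t\<^sup>2 * Hu w - t\<^sup>2 * Hw u\<bar> \<le> 2 * e * t\<^sup>2"
      using elim(1,2) by (simp add: algebra_simps)
    moreover have "t\<^sup>2 * Hu w - t\<^sup>2 * Hw u = t\<^sup>2 * (Hu w - Hw u)" by (simp add: algebra_simps)
    ultimately have "t\<^sup>2 * \<bar>Hu w - Hw u\<bar> \<le> t\<^sup>2 * (2 * e)"
      by (simp only: abs_mult) (simp add: mult_ac)
    then have "\<bar>Hu w - Hw u\<bar> \<le> 2 * e" using elim(3) by simp
    then show False using e by (simp add: e_def)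
  qed
  then show False by simp
qed

text \<open>The zero \<open>\<sigma> t\<close> of \<open>\<Phi> t\<close> has derivative zero, since \<open>c * \<bar>\<sigma> t - \<sigma> r\<bar> \<le> \<bar>\<Phi> t (\<sigma> r)\<bar>\<close> is of
  second order in \<open>t - r\<close>.\<close>

lemma zero_set_stationary:
  fixes \<Phi> :: "real \<Rightarrow> real \<Rightarrow> real"
  assumes pos: "\<epsilon> > 0" "c > 0"
    and ds: "\<And>t s. \<bar>t\<bar> \<le> \<epsilon> \<Longrightarrow> \<bar>s\<bar> \<le> \<epsilon> \<Longrightarrow> (\<Phi> t has_real_derivative \<Phi>s t s) (at s)"
    and c: "\<And>t s. \<bar>t\<bar> \<le> \<epsilon> \<Longrightarrow> \<bar>s\<bar> \<le> \<epsilon> \<Longrightarrow> \<Phi>s t s \<ge> c"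
    and dt: "\<And>t s. \<bar>t\<bar> \<le> \<epsilon> \<Longrightarrow> \<bar>s\<bar> \<le> \<epsilon> \<Longrightarrow> \<Phi> t s = 0 \<Longrightarrow> ((\<lambda>t. \<Phi> t s) has_real_derivative 0) (at t)"
    and cont: "\<And>s. \<bar>s\<bar> \<le> \<epsilon> \<Longrightarrow> isCont (\<lambda>t. \<Phi> t s) 0"
    and zero: "\<Phi> 0 0 = 0"
  shows "\<exists>\<delta>>0. \<forall>t. \<bar>t\<bar> < \<delta> \<longrightarrow> \<Phi> t 0 = 0"
proof -
  \<comment> \<open>The mean value theorem turns the lower bound on \<open>\<Phi>s\<close> into
    expansion in \<open>s\<close>, uniformly in \<open>t\<close>: distances in \<open>s\<close> are
    controlled by values of \<open>\<Phi> t\<close>.\<close>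
  have slope: "c * \<bar>s - r\<bar> \<le> \<bar>\<Phi> t s - \<Phi> t r\<bar> \<and> (r < s \<longrightarrow> \<Phi> t r < \<Phi> t s)"
    if "\<bar>t\<bar> \<le> \<epsilon>" "\<bar>s\<bar> \<le> \<epsilon>" "\<bar>r\<bar> \<le> \<epsilon>" for t s r
  proof -
    have *: "c * (b - a) \<le> \<Phi> t b - \<Phi> t a" if "a < b" "\<bar>a\<bar> \<le> \<epsilon>" "\<bar>b\<bar> \<le> \<epsilon>" for a b
    proof -
      have "(\<Phi> t has_real_derivative \<Phi>s t x) (at x)" if "a \<le> x" "x \<le> b" for x
        using ds[OF \<open>\<bar>t\<bar> \<le> \<epsilon>\<close>, of x] that \<open>\<bar>a\<bar> \<le> \<epsilon>\<close> \<open>\<bar>b\<bar> \<le> \<epsilon>\<close> by linarith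
      from MVT2[OF \<open>a < b\<close> this] obtain z where "a < z" "z < b" "\<Phi> t b - \<Phi> t a = (b - a) * \<Phi>s t z"
        by blast
      then show ?thesis using c[OF \<open>\<bar>t\<bar> \<le> \<epsilon>\<close>, of z] that by (simp add: mult.commute)
    qed
    consider "r < s" | "r = s" | "s < r" by linarith
    then show ?thesis
    proof cases
      case 1
      then have "c * (s - r) > 0" using pos by simp
      then show ?thesis using *[of r s] that 1 by auto
    next
      case 3
      then have "c * (r - s) > 0" using pos by simp
      then show ?thesis using *[of s r] that 3 by (auto simp: abs_if)
    qed simp
  qed
  have "\<Phi> 0 \<epsilon> > 0" "\<Phi> 0 (-\<epsilon>) < 0" using slope[of 0 \<epsilon> 0] slope[of 0 0 "-\<epsilon>"] zero pos by auto
  then have "\<forall>\<^sub>F t in at 0. \<Phi> t \<epsilon> > 0" "\<forall>\<^sub>F t in at 0. \<Phi> t (-\<epsilon>) < 0"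
    using cont[of \<epsilon>] cont[of "-\<epsilon>"] pos unfolding isCont_def by (auto intro: order_tendstoD)
  then have "\<forall>\<^sub>F t in at 0. \<Phi> t \<epsilon> > 0 \<and> \<Phi> t (-\<epsilon>) < 0" by eventually_elim auto
  then obtain d where d: "d > 0" "\<And>t. t \<noteq> 0 \<Longrightarrow> \<bar>t\<bar> < d \<Longrightarrow> \<Phi> t \<epsilon> > 0 \<and> \<Phi> t (-\<epsilon>) < 0"
    unfolding eventually_at by (auto simp: dist_real_def)
  define \<delta> where "\<delta> = min d \<epsilon>"
  have \<delta>: "\<delta> > 0" "\<delta> \<le> \<epsilon>" using d pos by (auto simp: \<delta>_def)
  have sign: "\<Phi> t \<epsilon> > 0" "\<Phi> t (-\<epsilon>) < 0" if "\<bar>t\<bar> < \<delta>" for t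
    using d(2)[of t] that \<open>\<Phi> 0 \<epsilon> > 0\<close> \<open>\<Phi> 0 (-\<epsilon>) < 0\<close> by (cases "t = 0"; auto simp: \<delta>_def)+
  \<comment> \<open>The signs at both ends persist for small \<open>t\<close>, so each such
    \<open>\<Phi> t\<close> has a zero, which \<open>\<sigma>\<close> selects.\<close>
  have "\<exists>s. \<bar>s\<bar> \<le> \<epsilon> \<and> \<Phi> t s = 0" if t: "\<bar>t\<bar> < \<delta>" for t
  proof -
    have "isCont (\<Phi> t) s" if "-\<epsilon> \<le> s" "s \<le> \<epsilon>" for s
      using DERIV_isCont[OF ds[of t s]] t \<delta> that by auto
    then obtain s where "-\<epsilon> \<le> s" "s \<le> \<epsilon>" "\<Phi> t s = 0"
      using IVT[of "\<Phi> t" "-\<epsilon>" 0 \<epsilon>] sign[OF t] pos by auto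
    then show ?thesis by (intro exI[of _ s]) auto
  qed
  then obtain \<sigma> where \<sigma>: "\<And>t. \<bar>t\<bar> < \<delta> \<Longrightarrow> \<bar>\<sigma> t\<bar> \<le> \<epsilon>" "\<And>t. \<bar>t\<bar> < \<delta> \<Longrightarrow> \<Phi> t (\<sigma> t) = 0"
    by metis
  have d\<sigma>: "(\<sigma> has_real_derivative 0) (at r)" if r: "\<bar>r\<bar> < \<delta>" for r
    unfolding has_field_derivative_def has_derivative_at_alt
  proof (intro conjI allI impI)
    fix e :: real assume e: "e > 0"
    have "((\<lambda>t. \<Phi> t (\<sigma> r)) has_real_derivative 0) (at r)"
      using dt \<sigma> r \<delta> by auto
    moreover have "e * c > 0" using e pos by simp
    ultimately obtain k where "k > 0" "\<And>t. norm (t - r) < k \<Longrightarrow>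
        norm (\<Phi> t (\<sigma> r) - \<Phi> r (\<sigma> r) - 0 * (t - r)) \<le> e * c * norm (t - r)"
      unfolding has_field_derivative_def has_derivative_at_alt by blast
    then have k: "k > 0" "\<And>t. \<bar>t - r\<bar> < k \<Longrightarrow> \<bar>\<Phi> t (\<sigma> r)\<bar> \<le> e * c * \<bar>t - r\<bar>"
      using \<sigma>(2)[OF r] by auto
    show "\<exists>d>0. \<forall>y. norm (y - r) < d \<longrightarrow> norm (\<sigma> y - \<sigma> r - 0 * (y - r)) \<le> e * norm (y - r)"
    proof (intro exI[of _ "min k (\<delta> - \<bar>r\<bar>)"] conjI allI impI)
      fix t assume t: "norm (t - r) < min k (\<delta> - \<bar>r\<bar>)"
      then have t': "\<bar>t\<bar> < \<delta>" by auto
      have "c * \<bar>\<sigma> t - \<sigma> r\<bar> \<le> \<bar>\<Phi> t (\<sigma> t) - \<Phi> t (\<sigma> r)\<bar>"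
        using slope[of t "\<sigma> t" "\<sigma> r"] t' r \<sigma> \<delta> by auto
      also have "\<dots> \<le> c * (e * \<bar>t - r\<bar>)" using k(2)[of t] t \<sigma>(2)[OF t'] by (simp add: mult_ac)
      finally show "norm (\<sigma> t - \<sigma> r - 0 * (t - r)) \<le> e * norm (t - r)" using pos by simp
    qed (use k r in auto)
  qed (rule bounded_linear_mult_right)
  have k: "\<sigma> t = \<sigma> 0" if "\<bar>t\<bar> < \<delta>" for t
    by (rule DERIV_isconst3[of "-\<delta>" \<delta>]) (use d\<sigma> that \<delta> in auto)
  have "c * \<bar>\<sigma> 0\<bar> \<le> 0" using slope[of 0 "\<sigma> 0" 0] \<sigma>[of 0] zero \<delta> by auto
  then have "\<sigma> 0 = 0" using pos by (auto simp: mult_le_0_iff)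
  then have "\<Phi> t 0 = 0" if "\<bar>t\<bar> < \<delta>" for t using k[OF that] \<sigma>(2)[OF that] by simp
  then show ?thesis using \<delta> by blast
qed

section \<open>Local equations on the cone\<close>

lemma directional_derivative_zero:
  fixes F :: "'a::real_normed_vector \<Rightarrow> 'b::real_normed_vector"
  assumes "(F has_derivative D) (at x)" and "\<forall>\<^sub>F t in nhds (0::real). F (x + t *\<^sub>R w) = F x"
  shows "D w = 0"
proof -
  have "((\<lambda>t. F (x + t *\<^sub>R w)) has_derivative (\<lambda>h. D (h *\<^sub>R w))) (at 0)"
    using assms(1)
    by (intro has_derivative_compose[of "\<lambda>t. x + t *\<^sub>R w" _ 0 UNIV F])
      (auto intro!: derivative_eq_intros)
  moreover have "((\<lambda>t. F (x + t *\<^sub>R w)) has_derivative (\<lambda>h. 0)) (at 0)"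
  proof (rule has_derivative_transform_eventually[OF has_derivative_const[of "F x"]])
    show "\<forall>\<^sub>F t in at 0. F x = F (x + t *\<^sub>R w)"
      using assms(2) unfolding eventually_at_filter by eventually_elim simp
  qed auto
  ultimately have "(\<lambda>h. D (h *\<^sub>R w)) = (\<lambda>h. 0)" by (rule has_derivative_unique)
  then have "D (1 *\<^sub>R w) = 0" by (rule fun_cong)
  then show ?thesis by simp
qed

lemma mem_real_line: "y \<in> real_line x \<longleftrightarrow> (\<exists>c. y = c *\<^sub>R x)"
  by (auto simp: real_line_def span_singleton)

lemma real_line_scale: "c \<noteq> 0 \<Longrightarrow> real_line (c *\<^sub>R x) = real_line x"
proof (intro set_eqI iffI)
  fix y assume c: "c \<noteq> 0" and "y \<in> real_line x"
  then obtain d where "y = d *\<^sub>R x" by (auto simp: mem_real_line)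
  then have "y = (d / c) *\<^sub>R c *\<^sub>R x" using c by simp
  then show "y \<in> real_line (c *\<^sub>R x)" unfolding mem_real_line by blast
qed (auto simp: mem_real_line)

lemma real_line_eqD: "real_line x = real_line y \<Longrightarrow> \<exists>c. y = c *\<^sub>R x"
  by (metis mem_real_line scaleR_one)

text \<open>The pullback of a local equation to the vector space, where the calculus takes place:
  \<open>F\<close> is homogeneous of degree 0 on an open cone without the origin.\<close>

definition cone_equation :: "'a::euclidean_space set set \<Rightarrow> 'a set \<Rightarrow> ('a \<Rightarrow> real) \<Rightarrow> bool" where
  "cone_equation \<Sigma> N F \<longleftrightarrow> open N \<and> smooth_on N F \<and>
     (\<forall>x\<in>N. x \<noteq> 0 \<and> (\<forall>t. t \<noteq> 0 \<longrightarrow> t *\<^sub>R x \<in> N \<and> F (t *\<^sub>R x) = F x)) \<and>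
     (\<forall>x\<in>N. real_line x \<in> \<Sigma> \<longleftrightarrow> F x = 0) \<and>
     (\<forall>x\<in>N. F x = 0 \<longrightarrow> (\<exists>w. frechet_derivative F (at x) w \<noteq> 0))"

lemma local_equation_imp_cone_equation:
  "local_equation real_line \<Sigma> U f \<Longrightarrow> cone_equation \<Sigma> (cone_over real_line U) (\<lambda>x. f (real_line x))"
  unfolding local_equation_def cone_equation_def quot_open_def cone_over_def
  by (auto simp: real_line_scale)

context
  fixes \<Sigma> :: "'a::euclidean_space set set" and N F
  assumes ce: "cone_equation \<Sigma> N F"
begin

lemma cone_equation_has_derivative:
  "x \<in> N \<Longrightarrow> (F has_derivative frechet_derivative F (at x)) (at x)"
  using ce unfolding cone_equation_def smooth_on_def
  by (metis Ck_on_has_derivative)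

lemma cone_equation_linear: "x \<in> N \<Longrightarrow> linear (frechet_derivative F (at x))"
  using cone_equation_has_derivative has_derivative_linear by blast

lemma cone_equation_has_derivative2:
  "x \<in> N \<Longrightarrow> ((\<lambda>y. frechet_derivative F (at y) b) has_derivative
     frechet_derivative (\<lambda>y. frechet_derivative F (at y) b) (at x)) (at x)"
proof -
  assume "x \<in> N"
  have "Ck_on (Suc (Suc 0)) N F" using ce unfolding cone_equation_def smooth_on_def by blast
  then have "Ck_on (Suc 0) N (\<lambda>y. frechet_derivative F (at y) b)" unfolding Ck_on.simps(2)[of "Suc 0"] by blast
  then show ?thesis using \<open>x \<in> N\<close> by (rule Ck_on_has_derivative)
qed

lemma cone_equation_continuous_on: "continuous_on N F"
  using ce unfolding cone_equation_def smooth_on_def by (metis Ck_on.simps(1))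

text \<open>Euler's relation in degree 0.\<close>

lemma cone_equation_euler: "x \<in> N \<Longrightarrow> frechet_derivative F (at x) x = 0"
proof -
  assume x: "x \<in> N"
  have "F (x + t *\<^sub>R x) = F x" if "\<bar>t\<bar> < 1" for t
  proof -
    have "1 + t \<noteq> 0" using that by auto
    then have "F ((1 + t) *\<^sub>R x) = F x" using ce x unfolding cone_equation_def by blast
    then show ?thesis by (simp add: algebra_simps)
  qed
  then have "\<forall>\<^sub>F t in nhds 0. F (x + t *\<^sub>R x) = F x"
    unfolding eventually_nhds_metric by (intro exI[of _ 1]) (auto simp: dist_real_def)
  then show ?thesis
    using directional_derivative_zero cone_equation_has_derivative[OF x] by blast
qed

text \<open>Differentiating \<open>F (c y) = F y\<close> shows that the derivative is homogeneous of
  degree -1, so its kernel is the same at all lifts of a point.\<close>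

lemma cone_equation_scale:
  assumes x: "x \<in> N" and c: "c \<noteq> 0"
  shows "frechet_derivative F (at (c *\<^sub>R x)) (c *\<^sub>R w) = frechet_derivative F (at x) w"
proof -
  have cx: "c *\<^sub>R x \<in> N" using ce x c unfolding cone_equation_def by blast
  have "((\<lambda>y. F (c *\<^sub>R y)) has_derivative (\<lambda>w. frechet_derivative F (at (c *\<^sub>R x)) (c *\<^sub>R w))) (at x)"
    using cone_equation_has_derivative[OF cx]
    by (intro has_derivative_compose[of "\<lambda>y. c *\<^sub>R y" _ x UNIV F])
      (auto intro!: derivative_eq_intros)
  moreover have "F (c *\<^sub>R y) = F y" if "y \<in> N" for y
    using that c ce unfolding cone_equation_def by blast
  ultimately have "(F has_derivative (\<lambda>w. frechet_derivative F (at (c *\<^sub>R x)) (c *\<^sub>R w))) (at x)"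
    using x ce unfolding cone_equation_def
    by (blast intro: has_derivative_transform_within_open)
  from has_derivative_unique[OF this cone_equation_has_derivative[OF x]]
  show ?thesis by (rule fun_cong)
qed

end

text \<open>Both equations cut out the same set on \<open>N \<inter> M\<close>, so
  \<open>zero_set_derivative\<close> compares their differentials.\<close>

lemma cone_equations_same_kernel:
  assumes F: "cone_equation \<Sigma> N F" and G: "cone_equation \<Sigma> M G"
    and x: "x \<in> N" "x \<in> M" "F x = 0" and w: "frechet_derivative F (at x) w = 0"
  shows "frechet_derivative G (at x) w = 0"
proof -
  have o: "open (N \<inter> M)" using F G unfolding cone_equation_def by auto
  obtain u where u: "frechet_derivative F (at x) u \<noteq> 0" using F x unfolding cone_equation_def by blast
  have c: "continuous_on (N \<inter> M) F"
    using cone_equation_continuous_on[OF F] by (rule continuous_on_subset) auto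
  have z: "\<And>y. y \<in> N \<inter> M \<Longrightarrow> F y = 0 \<Longrightarrow> G y = 0"
    using F G unfolding cone_equation_def by (metis IntD1 IntD2)
  show ?thesis
    by (rule zero_set_derivative[OF cone_equation_has_derivative[OF F x(1)]
          cone_equation_has_derivative[OF G x(2)] o _ c x(3) z u w]) (use x in auto)
qed

text \<open>\<open>tangent_hyperplane\<close> quantifies over all local equations and all lifts.
  Equality of kernels for different equations, together with homogeneity in the lift, reduces it to
  a single equation that serves all nearby points of the table.\<close>

lemma table_equation:
  assumes "table \<Sigma>" "v \<noteq> 0" "real_line v \<in> \<Sigma>"
  obtains N F where "cone_equation \<Sigma> N F" "v \<in> N" "F v = 0"
    and "\<And>x. x \<in> N \<Longrightarrow> F x = 0 \<Longrightarrow> tangent_hyperplane \<Sigma> (real_line x) = {w. frechet_derivative F (at x) w = 0}"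
proof -
  obtain U f where Uf: "real_line v \<in> U" "local_equation real_line \<Sigma> U f"
    using assms unfolding table_def hypersurface_def by blast
  define N where "N = cone_over real_line U"
  define F where "F = (\<lambda>x. f (real_line x))"
  have ce: "cone_equation \<Sigma> N F"
    unfolding N_def F_def by (rule local_equation_imp_cone_equation[OF Uf(2)])
  have v: "v \<in> N" using Uf assms unfolding N_def cone_over_def by blast
  then have v0: "F v = 0" using ce assms unfolding cone_equation_def by blast
  have T: "tangent_hyperplane \<Sigma> (real_line x) = {w. frechet_derivative F (at x) w = 0}"
    if x: "x \<in> N" "F x = 0" for x
  proof (intro set_eqI iffI)
    fix w assume "w \<in> tangent_hyperplane \<Sigma> (real_line x)"
    moreover have "x \<in> real_line x - {0}" "real_line x \<in> U"
      using x unfolding N_def cone_over_def mem_real_line by (auto simp: real_line_def span_base)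
    ultimately show "w \<in> {w. frechet_derivative F (at x) w = 0}"
      using Uf(2) unfolding tangent_hyperplane_def F_def by blast
  next
    fix w assume w: "w \<in> {w. frechet_derivative F (at x) w = 0}"
    show "w \<in> tangent_hyperplane \<Sigma> (real_line x)"
      unfolding tangent_hyperplane_def
    proof (intro CollectI allI ballI impI, elim conjE)
      fix U' f' y assume y: "y \<in> real_line x - {0}" and U': "real_line x \<in> U'"
        and le: "local_equation real_line \<Sigma> U' f'"
      let ?M = "cone_over real_line U'" and ?G = "\<lambda>x. f' (real_line x)"
      have ce': "cone_equation \<Sigma> ?M ?G"
        by (rule local_equation_imp_cone_equation[OF le])
      obtain c where c: "y = c *\<^sub>R x" "c \<noteq> 0" using y by (auto simp: mem_real_line)
      have xM: "x \<in> ?M" using U' x ce unfolding cone_over_def cone_equation_def by blast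
      \<comment> \<open>Moving the base point from \<open>x\<close> to \<open>y = c x\<close> costs
        a factor \<open>c\<close> in the argument.\<close>
      have "frechet_derivative ?G (at x) (w /\<^sub>R c) = 0"
        using cone_equations_same_kernel[OF ce ce' x(1) xM x(2)] w
          linear_scale[OF cone_equation_linear[OF ce x(1)]] by simp
      then show "frechet_derivative ?G (at y) w = 0"
        using cone_equation_scale[OF ce' xM c(2), of "w /\<^sub>R c"] c by simp
    qed
  qed
  show thesis by (rule that[OF ce v v0 T])
qed

section \<open>The polar point and complex tangency\<close>

locale compatible_symplectic =
  fixes \<omega> :: "'a::euclidean_space \<Rightarrow> 'a \<Rightarrow> real" and J :: "'a \<Rightarrow> 'a"
  assumes symplectic: "symplectic_form \<omega>" and compatible: "compatible_complex_structure \<omega> J"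
begin

sublocale form: bounded_bilinear \<omega>
  using symplectic bilinear_conv_bounded_bilinear unfolding symplectic_form_def by blast

sublocale J: bounded_linear J
  using compatible linear_conv_bounded_linear unfolding compatible_complex_structure_def by blast

lemma form_self [simp]: "\<omega> u u = 0"
  using symplectic unfolding symplectic_form_def by blast

lemma form_skew: "\<omega> u v = - \<omega> v u"
  using form_self[of "u + v"] unfolding form.add_left form.add_right by simp

lemma form_nondegenerate: "(\<And>v. \<omega> u v = 0) \<Longrightarrow> u = 0"
  using symplectic unfolding symplectic_form_def by blast

lemma J_J [simp]: "J (J v) = - v"
  using compatible unfolding compatible_complex_structure_def by blast

lemma form_J_J [simp]: "\<omega> (J u) (J v) = \<omega> u v"
  using compatible unfolding compatible_complex_structure_def by blast

lemma form_J_left: "\<omega> (J u) v = - \<omega> u (J v)"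
  using form_J_J[of u "J v"] by (simp add: form.minus_right)

lemma form_J_pos: "u \<noteq> 0 \<Longrightarrow> \<omega> u (J u) > 0"
  using compatible unfolding compatible_complex_structure_def by blast

text \<open>\<open>\<Omega>\<close> expresses the form through the Euclidean inner product.
  Nondegeneracy makes it injective, hence invertible in finite dimension, and \<open>L\<close> is
  its inverse.\<close>

lemma riesz_form: "\<exists>L. linear L \<and> (\<forall>y w. \<omega> (L y) w = y \<bullet> w)"
proof -
  define \<Omega> where "\<Omega> = (\<lambda>u. \<Sum>b\<in>Basis. \<omega> u b *\<^sub>R b)"
  have \<Omega>: "\<Omega> u \<bullet> w = \<omega> u w" for u w
  proof -
    have "\<omega> u w = (\<Sum>b\<in>Basis. (w \<bullet> b) *\<^sub>R \<omega> u b)"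
      by (rule linear_basis_expansion) (simp add: bounded_linear.linear form.bounded_linear_right)
    then show ?thesis by (simp add: \<Omega>_def inner_sum_left inner_sum_right inner_commute mult.commute)
  qed
  have "linear \<Omega>"
    unfolding \<Omega>_def by (rule linearI)
      (simp_all add: form.add_left form.scaleR_left scaleR_add_left sum.distrib scaleR_sum_right)
  moreover have "inj \<Omega>"
    unfolding linear_injective_0[OF \<open>linear \<Omega>\<close>]
  proof (intro allI impI)
    fix u assume "\<Omega> u = 0"
    then show "u = 0" using \<Omega>[of u] by (intro form_nondegenerate) simp
  qed
  ultimately obtain L where "linear L" "\<And>y. \<Omega> (L y) = y"
    using linear_injective_isomorphism by metis
  then show ?thesis using \<Omega> by metis
qed

section \<open>The symplectic gradient of an equation\<close>

definition sharp :: "'a \<Rightarrow> 'a" where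
  "sharp = (SOME L. linear L \<and> (\<forall>y w. \<omega> (L y) w = y \<bullet> w))"

lemma linear_sharp: "linear sharp" and form_sharp: "\<omega> (sharp y) w = y \<bullet> w"
  using someI_ex[OF riesz_form] unfolding sharp_def by blast+

text \<open>The Hamiltonian vector of \<open>F\<close>, up to the sign convention. At a zero of an
  equation of the table it is a lift of the polar point, and the fixed linear map
  \<open>sharp\<close> lets it inherit differentiability from the partial derivatives.\<close>

definition sgrad :: "('a \<Rightarrow> real) \<Rightarrow> 'a \<Rightarrow> 'a" where
  "sgrad F x = sharp (\<Sum>b\<in>Basis. frechet_derivative F (at x) b *\<^sub>R b)"

lemma form_sgrad:
  assumes "cone_equation \<Sigma> N F" "x \<in> N"
  shows "\<omega> (sgrad F x) w = frechet_derivative F (at x) w"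
  using linear_basis_expansion[OF cone_equation_linear[OF assms], of w]
  by (simp add: sgrad_def form_sharp inner_sum_left inner_sum_right inner_commute mult.commute)

lemma sgrad_has_derivative:
  assumes "cone_equation \<Sigma> N F" "x \<in> N"
  shows "\<exists>p'. (sgrad F has_derivative p') (at x)"
proof -
  have "bounded_linear sharp" using linear_sharp by (simp add: linear_conv_bounded_linear)
  moreover have "((\<lambda>y. \<Sum>b\<in>Basis. frechet_derivative F (at y) b *\<^sub>R b) has_derivative
      (\<lambda>h. \<Sum>b\<in>Basis. frechet_derivative (\<lambda>y. frechet_derivative F (at y) b) (at x) h *\<^sub>R b)) (at x)"
    by (intro has_derivative_sum has_derivative_scaleR_left cone_equation_has_derivative2[OF assms])
  ultimately show ?thesis
    unfolding sgrad_def[abs_def] using bounded_linear.has_derivative by blast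
qed

lemma form_sgrad_self: "cone_equation \<Sigma> N F \<Longrightarrow> x \<in> N \<Longrightarrow> \<omega> (sgrad F x) x = 0"
  using form_sgrad cone_equation_euler by metis

lemma sgrad_nonzero:
  assumes "cone_equation \<Sigma> N F" "x \<in> N" "F x = 0"
  shows "sgrad F x \<noteq> 0"
  using assms form_sgrad[OF assms(1,2)] unfolding cone_equation_def
  by (metis form.zero_left)

lemma symp_perp_kernel:
  assumes "p \<noteq> 0"
  shows "symp_perp \<omega> {w. \<omega> p w = 0} = real_line p"
proof (intro set_eqI iffI)
  fix u assume u: "u \<in> symp_perp \<omega> {w. \<omega> p w = 0}"
  obtain w0 where w0: "\<omega> p w0 \<noteq> 0" using form_nondegenerate assms by blast
  \<comment> \<open>The multiple of \<open>p\<close> is chosen to match \<open>u\<close> on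
    \<open>w0\<close>. Every \<open>w\<close> differs from a multiple of \<open>w0\<close> by a
    vector of the kernel, on which \<open>u\<close> and \<open>p\<close> both vanish.\<close>
  have "\<omega> (u - (\<omega> u w0 / \<omega> p w0) *\<^sub>R p) w = 0" for w
  proof -
    have "\<omega> p (w - (\<omega> p w / \<omega> p w0) *\<^sub>R w0) = 0"
      using w0 by (simp add: form.diff_right form.scaleR_right)
    then have "\<omega> u (w - (\<omega> p w / \<omega> p w0) *\<^sub>R w0) = 0"
      using u unfolding symp_perp_def by blast
    then show ?thesis
      by (simp add: form.diff_right form.scaleR_right form.diff_left form.scaleR_left)
  qed
  then have "u - (\<omega> u w0 / \<omega> p w0) *\<^sub>R p = 0" by (rule form_nondegenerate)
  then show "u \<in> real_line p" unfolding mem_real_line by auto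
qed (auto simp: symp_perp_def mem_real_line form.scaleR_left)

lemma self_mem_real_line: "v \<in> real_line v"
  by (simp add: real_line_def span_base)

lemma contact_hyperplane_real_line: "w \<in> contact_hyperplane \<omega> (real_line v) \<longleftrightarrow> \<omega> w v = 0"
  using self_mem_real_line[of v] unfolding contact_hyperplane_def symp_perp_def
  by (auto simp: form.scaleR_right mem_real_line)

lemma table_sgrad:
  assumes "table \<Sigma>" "v \<noteq> 0" "real_line v \<in> \<Sigma>"
  obtains N F where "cone_equation \<Sigma> N F" "v \<in> N" "F v = 0"
    and "\<And>x. x \<in> N \<Longrightarrow> F x = 0 \<Longrightarrow> tangent_hyperplane \<Sigma> (real_line x) = {w. \<omega> (sgrad F x) w = 0}"
    and "\<And>x. x \<in> N \<Longrightarrow> F x = 0 \<Longrightarrow> polar_point \<omega> \<Sigma> (real_line x) = real_line (sgrad F x)"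
proof -
  obtain N F where ce: "cone_equation \<Sigma> N F" "v \<in> N" "F v = 0"
    and T: "\<And>x. x \<in> N \<Longrightarrow> F x = 0 \<Longrightarrow> tangent_hyperplane \<Sigma> (real_line x) = {w. frechet_derivative F (at x) w = 0}"
    using table_equation[OF assms] by metis
  have T': "tangent_hyperplane \<Sigma> (real_line x) = {w. \<omega> (sgrad F x) w = 0}" if "x \<in> N" "F x = 0" for x
    using T[OF that] form_sgrad[OF ce(1) that(1)] by simp
  show thesis
    by (rule that[OF ce T']) (simp_all add: T' polar_point_def symp_perp_kernel sgrad_nonzero[OF ce(1)])
qed

text \<open>The condition through which the others are compared: the orbits of the circle action
  generated by \<open>J\<close> are tangent to the table.\<close>

definition tangent_J :: "'a set set \<Rightarrow> bool" where
  "tangent_J \<Sigma> \<longleftrightarrow> (\<forall>v. v \<noteq> 0 \<longrightarrow> real_line v \<in> \<Sigma> \<longrightarrow> J v \<in> tangent_hyperplane \<Sigma> (real_line v))"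

section \<open>The two rules in coordinates of the characteristic line\<close>

lemma span_real_lines: "span (real_line x \<union> real_line p) = {\<alpha> *\<^sub>R x + \<beta> *\<^sub>R p | \<alpha> \<beta>. True}"
proof -
  have "span (real_line x \<union> real_line p) = {a + b | a b. a \<in> real_line x \<and> b \<in> real_line p}"
    unfolding real_line_def span_Un span_span ..
  then show ?thesis by (auto simp: mem_real_line)
qed

lemma line_reflection_scale:
  "t \<noteq> 0 \<Longrightarrow> line_reflection (g_J \<omega> J) (t *\<^sub>R a) z = line_reflection (g_J \<omega> J) a z"
  by (simp add: line_reflection_def g_J_def form.scaleR_left form.scaleR_right J.scaleR)

text \<open>The reflection does not see the scale of \<open>a\<close>, so \<open>a\<close> can be
  fixed as \<open>x\<close>. The result has the same shape as \<open>outer_rule_iff\<close>, which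
  makes the rules comparable.\<close>

lemma angle_rule_iff:
  assumes x: "x \<noteq> 0" "real_line x \<in> \<Sigma>" and p: "polar_point \<omega> \<Sigma> (real_line x) = real_line p"
  shows "angle_rule \<omega> (g_J \<omega> J) \<Sigma> (real_line x) Z Z' \<longleftrightarrow> real_line p \<noteq> real_line x \<and>
    (\<exists>\<alpha> \<beta>. \<alpha> *\<^sub>R x + \<beta> *\<^sub>R p \<noteq> 0 \<and> Z = real_line (\<alpha> *\<^sub>R x + \<beta> *\<^sub>R p) \<and>
       Z' = real_line (line_reflection (g_J \<omega> J) x (\<alpha> *\<^sub>R x + \<beta> *\<^sub>R p)))"
proof -
  have ex: "(\<exists>a\<in>real_line x - {0}. P (line_reflection (g_J \<omega> J) a z)) \<longleftrightarrow> P (line_reflection (g_J \<omega> J) x z)" for P z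
  proof
    assume "\<exists>a\<in>real_line x - {0}. P (line_reflection (g_J \<omega> J) a z)"
    then obtain a where a: "a \<in> real_line x" "a \<noteq> 0" "P (line_reflection (g_J \<omega> J) a z)" by blast
    then obtain c where "a = c *\<^sub>R x" using mem_real_line by blast
    with a show "P (line_reflection (g_J \<omega> J) x z)" using line_reflection_scale[of c x z] by auto
  qed (use x self_mem_real_line[of x] in blast)
  have "angle_rule \<omega> (g_J \<omega> J) \<Sigma> (real_line x) Z Z' \<longleftrightarrow> real_line p \<noteq> real_line x \<and>
    (\<exists>z\<in>{\<alpha> *\<^sub>R x + \<beta> *\<^sub>R p | \<alpha> \<beta>. True} - {0}. \<exists>a\<in>real_line x - {0}.
       Z = real_line z \<and> Z' = real_line (line_reflection (g_J \<omega> J) a z))"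
    using x unfolding angle_rule_def characteristic_line_def p span_real_lines by blast
  also have "\<dots> \<longleftrightarrow> real_line p \<noteq> real_line x \<and>
    (\<exists>z\<in>{\<alpha> *\<^sub>R x + \<beta> *\<^sub>R p | \<alpha> \<beta>. True} - {0}.
       Z = real_line z \<and> Z' = real_line (line_reflection (g_J \<omega> J) x z))"
    using ex[where P = "\<lambda>r. Z = real_line z \<and> Z' = real_line r" for z] by simp
  finally show ?thesis by blast
qed

lemma outer_rule_iff:
  assumes x: "x \<noteq> 0" "real_line x \<in> \<Sigma>" and p: "polar_point \<omega> \<Sigma> (real_line x) = real_line p"
  shows "outer_rule \<omega> \<Sigma> (real_line x) Z Z' \<longleftrightarrow> real_line p \<noteq> real_line x \<and>
    (\<exists>\<alpha> \<beta>. \<alpha> *\<^sub>R x + \<beta> *\<^sub>R p \<noteq> 0 \<and> Z = real_line (\<alpha> *\<^sub>R x + \<beta> *\<^sub>R p) \<and>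
       Z' = real_line (\<alpha> *\<^sub>R x - \<beta> *\<^sub>R p))"
proof -
  have "(\<exists>a\<in>real_line x. \<exists>b\<in>real_line p. Q a b) \<longleftrightarrow> (\<exists>\<alpha> \<beta>. Q (\<alpha> *\<^sub>R x) (\<beta> *\<^sub>R p))" for Q
    by (metis mem_real_line)
  then show ?thesis using x unfolding outer_rule_def p by simp
qed

lemma line_reflection_orthogonal:
  assumes "x \<noteq> 0" "\<omega> p (J x) = 0"
  shows "line_reflection (g_J \<omega> J) x (\<alpha> *\<^sub>R x + \<beta> *\<^sub>R p) = \<alpha> *\<^sub>R x - \<beta> *\<^sub>R p"
  using form_J_pos[OF assms(1)] assms(2)
  by (simp add: line_reflection_def g_J_def form.scaleR_left form.add_left algebra_simps flip: scaleR_add_left)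

lemma tangent_J_imp_rules_coincide:
  assumes "table \<Sigma>" "tangent_J \<Sigma>"
  shows "rules_coincide (angle_rule \<omega> (g_J \<omega> J) \<Sigma>) (outer_rule \<omega> \<Sigma>)"
  unfolding rules_coincide_def
proof (intro allI)
  fix q Z Z'
  show "angle_rule \<omega> (g_J \<omega> J) \<Sigma> q Z Z' \<longleftrightarrow> outer_rule \<omega> \<Sigma> q Z Z'"
  proof (cases "q \<in> \<Sigma>")
    case True
    then obtain x where x: "q = real_line x" "x \<noteq> 0"
      using assms(1) unfolding table_def hypersurface_def quot_space_def by auto
    then obtain N F where ce: "cone_equation \<Sigma> N F" "x \<in> N" "F x = 0"
      and T: "tangent_hyperplane \<Sigma> (real_line x) = {w. \<omega> (sgrad F x) w = 0}"
      and p: "polar_point \<omega> \<Sigma> (real_line x) = real_line (sgrad F x)"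
      using table_sgrad[OF assms(1), of x] True by metis
    have o: "\<omega> (sgrad F x) (J x) = 0" using assms(2) x True T unfolding tangent_J_def by blast
    show ?thesis
      using True unfolding x(1)
      by (simp add: angle_rule_iff[OF x(2) _ p] outer_rule_iff[OF x(2) _ p] line_reflection_orthogonal[OF x(2) o])
  qed (auto simp: angle_rule_def outer_rule_def)
qed

text \<open>The test point is the polar point itself, which the harmonic involution fixes. A
  reflection of the plane fixes a line other than its axis only if that line is orthogonal to the
  axis.\<close>

lemma rules_coincide_imp_orthogonal:
  assumes rc: "rules_coincide (angle_rule \<omega> (g_J \<omega> J) \<Sigma>) (outer_rule \<omega> \<Sigma>)"
    and x: "x \<noteq> 0" "real_line x \<in> \<Sigma>" and p: "polar_point \<omega> \<Sigma> (real_line x) = real_line p" "p \<noteq> 0"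
    and ne: "real_line p \<noteq> real_line x"
  shows "\<omega> p (J x) = 0"
proof -
  have "0 *\<^sub>R x + 1 *\<^sub>R p \<noteq> 0 \<and> real_line p = real_line (0 *\<^sub>R x + 1 *\<^sub>R p) \<and>
      real_line p = real_line (0 *\<^sub>R x - 1 *\<^sub>R p)"
    using p(2) real_line_scale[of "-1" p] by simp
  then have "outer_rule \<omega> \<Sigma> (real_line x) (real_line p) (real_line p)"
    unfolding outer_rule_iff[OF x p(1)] using ne by blast
  then have "angle_rule \<omega> (g_J \<omega> J) \<Sigma> (real_line x) (real_line p) (real_line p)"
    using rc unfolding rules_coincide_def by blast
  then obtain z where z: "z \<noteq> 0" "real_line p = real_line z"
    "real_line p = real_line (line_reflection (g_J \<omega> J) x z)"
    unfolding angle_rule_iff[OF x p(1)] by blast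
  obtain c where c: "z = c *\<^sub>R p" using z(2) real_line_eqD by blast
  then have c0: "c \<noteq> 0" using z by auto
  obtain d where d: "line_reflection (g_J \<omega> J) x z = d *\<^sub>R p" using z(3) real_line_eqD by blast
  \<comment> \<open>\<open>k *\<^sub>R x\<close> is the sum of \<open>z\<close> and its reflection,
    both of which are multiples of \<open>p\<close>.\<close>
  define k where "k = 2 * \<omega> z (J x) / \<omega> x (J x)"
  have k: "k *\<^sub>R x = (c + d) *\<^sub>R p"
    using d c by (simp add: line_reflection_def g_J_def k_def scaleR_add_left diff_eq_eq add.commute)
  have "k = 0"
  proof (rule ccontr)
    assume k0: "k \<noteq> 0"
    then have "(c + d) \<noteq> 0" using k x(1) by auto
    then show False using real_line_scale[OF k0, of x] real_line_scale[of "c + d" p] k ne by simp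
  qed
  then show ?thesis using form_J_pos[OF x(1)] c0 by (auto simp: k_def c form.scaleR_left)
qed

text \<open>In at least three dimensions some nonzero \<open>u\<close> is
  \<open>\<omega>\<close>-orthogonal to both \<open>v\<close> and \<open>J v\<close>. Then
  \<open>u\<close> and \<open>J u\<close> lie in the kernel of \<open>\<omega> v\<close>, although
  \<open>\<omega> u (J u)\<close> is positive.\<close>

lemma isotropic_hyperplane_contradiction:
  assumes "DIM('a) \<ge> 3" "\<And>u w. \<omega> v u = 0 \<Longrightarrow> \<omega> v w = 0 \<Longrightarrow> \<omega> u w = 0"
  shows False
proof -
  obtain L where L: "\<And>y w. \<omega> (L y) w = y \<bullet> w" "linear L" using riesz_form by blast
  have "surj L"
  proof -
    have "inj L" unfolding linear_injective_0[OF L(2)]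
      using L(1) by (metis form.zero_left inner_eq_zero_iff)
    then show ?thesis using linear_injective_imp_surjective[OF L(2)] by blast
  qed
  \<comment> \<open>\<open>L\<close> turns \<open>\<omega>\<close>-orthogonality to \<open>v\<close>
    and \<open>J v\<close> into Euclidean orthogonality to \<open>a\<close> and \<open>b\<close>,
    which span at most a plane.\<close>
  then obtain a b where ab: "v = L a" "J v = L b" by (metis surjD)
  have "dim {a, b} < DIM('a)"
    using dim_le_card'[of "{a, b}"] card_insert_le_m1[of 2 "{b}" a] assms(1) by (simp add: card_insert_if split: if_splits)
  then obtain u where u: "u \<noteq> 0" "\<And>y. y \<in> span {a, b} \<Longrightarrow> orthogonal u y"
    using orthogonal_to_subspace_exists by metis
  then have "a \<bullet> u = 0" "b \<bullet> u = 0" by (auto simp: orthogonal_def inner_commute span_base)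
  then have "\<omega> v u = 0" "\<omega> (J v) u = 0"
    using L(1)[of a u, folded ab] L(1)[of b u, folded ab] by simp_all
  then have "\<omega> u (J u) = 0" using assms(2) by (metis form_J_left neg_equal_zero neg_0_equal_iff_equal)
  then show False using form_J_pos u(1) by fastforce
qed

text \<open>Both sides are the Hessian of \<open>F\<close> at \<open>x\<close>, evaluated on
  \<open>u\<close> and \<open>w\<close>.\<close>

lemma second_derivative_sgrad_sym:
  assumes ce: "cone_equation \<Sigma> N F" "x \<in> N" and p': "(sgrad F has_derivative p') (at x)"
  shows "\<omega> (p' u) w = \<omega> (p' w) u"
proof -
  have o: "open N" using ce unfolding cone_equation_def by blast
  have d: "((\<lambda>y. frechet_derivative F (at y) w) has_derivative (\<lambda>u. \<omega> (p' u) w)) (at x)" for w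
  proof (rule has_derivative_transform_within_open[OF _ o ce(2)])
    show "((\<lambda>y. \<omega> (sgrad F y) w) has_derivative (\<lambda>u. \<omega> (p' u) w)) (at x)"
      using bounded_linear.has_derivative[OF form.bounded_linear_left p'] .
  qed (simp add: form_sgrad[OF ce(1)])
  from second_derivative_symmetric[OF o ce(2) cone_equation_has_derivative[OF ce(1)] d d]
  show ?thesis by simp
qed

text \<open>Where \<open>J v\<close> is not tangent, coincidence of the rules forces the polar point
  to be the point itself on a neighbourhood in the table, which is then an integral hypersurface of
  the contact structure. There the Hessian is a nonzero multiple of \<open>\<omega>\<close> on the
  tangent hyperplane. Being symmetric, it makes that hyperplane isotropic.\<close>

lemma rules_coincide_imp_tangent_J:
  assumes dim: "DIM('a) \<ge> 3" and tab: "table \<Sigma>"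
    and rc: "rules_coincide (angle_rule \<omega> (g_J \<omega> J) \<Sigma>) (outer_rule \<omega> \<Sigma>)"
  shows "tangent_J \<Sigma>"
  unfolding tangent_J_def
proof (intro allI impI)
  fix v :: 'a assume v: "v \<noteq> 0" "real_line v \<in> \<Sigma>"
  obtain N F where ce: "cone_equation \<Sigma> N F" "v \<in> N" "F v = 0"
    and T: "\<And>x. x \<in> N \<Longrightarrow> F x = 0 \<Longrightarrow> tangent_hyperplane \<Sigma> (real_line x) = {w. \<omega> (sgrad F x) w = 0}"
    and P: "\<And>x. x \<in> N \<Longrightarrow> F x = 0 \<Longrightarrow> polar_point \<omega> \<Sigma> (real_line x) = real_line (sgrad F x)"
    using table_sgrad[OF tab v] by metis
  have oN: "open N" using ce unfolding cone_equation_def by blast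
  define \<kappa> where "\<kappa> = (\<lambda>y. \<omega> (sgrad F y) (J y))"
  have "\<kappa> v = 0"
  proof (rule ccontr)
    assume \<kappa>v: "\<kappa> v \<noteq> 0"
    obtain p' where p': "(sgrad F has_derivative p') (at v)" using sgrad_has_derivative[OF ce(1,2)] by blast
    note Jd = J.has_derivative[OF has_derivative_ident]
    obtain \<kappa>' where \<kappa>': "(\<kappa> has_derivative \<kappa>') (at v)"
      unfolding \<kappa>_def using form.FDERIV[OF p' Jd] by blast
    have par: "\<exists>c. sgrad F y = c *\<^sub>R y" if y: "y \<in> N" "F y = 0" "\<kappa> y \<noteq> 0" for y
    proof -
      have y': "y \<noteq> 0" "real_line y \<in> \<Sigma>" using ce(1) y unfolding cone_equation_def by blast+
      have "real_line (sgrad F y) = real_line y"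
        using rules_coincide_imp_orthogonal[OF rc y' P[OF y(1,2)] sgrad_nonzero[OF ce(1) y(1,2)]] y(3)
        unfolding \<kappa>_def by blast
      then show ?thesis using real_line_eqD by metis
    qed
    have "isCont \<kappa> v" using \<kappa>' has_derivative_continuous by blast
    then have "\<forall>\<^sub>F y in at v. \<kappa> y \<noteq> 0" using \<kappa>v by (auto simp: isCont_def intro: tendsto_imp_eventually_ne)
    then have "\<forall>\<^sub>F y in nhds v. \<kappa> y \<noteq> 0" using \<kappa>v by (simp add: eventually_nhds_conv_at)
    then obtain M where M: "open M" "v \<in> M" "\<And>y. y \<in> M \<Longrightarrow> \<kappa> y \<noteq> 0" unfolding eventually_nhds by blast
    obtain u0 where u0: "frechet_derivative F (at v) u0 \<noteq> 0" using ce unfolding cone_equation_def by blast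
    obtain c where c: "sgrad F v = c *\<^sub>R v" using par[OF ce(2,3) \<kappa>v] by blast
    have c0: "c \<noteq> 0" using c sgrad_nonzero[OF ce] by auto
    have key: "\<omega> (p' u) w * \<omega> v (J v) = \<kappa> v * \<omega> u w" if "\<omega> v u = 0" "\<omega> v w = 0" for u w
    proof -
      \<comment> \<open>\<open>sgrad F y\<close> is parallel to \<open>y\<close> with factor
        \<open>\<kappa> y / \<omega> y (J y)\<close>. \<open>G\<close> expresses this without a
        denominator, tested on \<open>w\<close>; it vanishes on the table near \<open>v\<close>, so
        its derivative vanishes on the tangent vector \<open>u\<close>.\<close>
      define G where "G = (\<lambda>y. \<omega> (sgrad F y) w * \<omega> y (J y) - \<kappa> y * \<omega> y w)"
      have G: "(G has_derivative (\<lambda>h. (\<omega> (sgrad F v) w * (\<omega> v (J h) + \<omega> h (J v)) + \<omega> (p' h) w * \<omega> v (J v))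
          - (\<kappa> v * \<omega> h w + \<kappa>' h * \<omega> v w))) (at v)"
        unfolding G_def
        by (intro has_derivative_diff has_derivative_mult form.FDERIV[OF has_derivative_ident Jd] \<kappa>'
            bounded_linear.has_derivative[OF form.bounded_linear_left] p' has_derivative_ident)
      have z: "G y = 0" if y: "y \<in> N \<inter> M" "F y = 0" for y
      proof -
        have "y \<in> N" "y \<in> M" using y(1) by auto
        then obtain d where "sgrad F y = d *\<^sub>R y" using par[OF _ y(2)] M(3) by blast
        then show ?thesis by (simp add: G_def \<kappa>_def form.scaleR_left)
      qed
      have "frechet_derivative F (at v) u = 0"
        using form_sgrad[OF ce(1,2), of u] that by (simp add: c form.scaleR_left)
      moreover have "continuous_on (N \<inter> M) F"
        using cone_equation_continuous_on[OF ce(1)] by (rule continuous_on_subset) auto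
      ultimately have "(\<omega> (sgrad F v) w * (\<omega> v (J u) + \<omega> u (J v)) + \<omega> (p' u) w * \<omega> v (J v))
          - (\<kappa> v * \<omega> u w + \<kappa>' u * \<omega> v w) = 0"
        using oN M(1,2) ce(2)
        by (intro zero_set_derivative[OF cone_equation_has_derivative[OF ce(1,2)] G _ _ _ ce(3) z u0,
              of "N \<inter> M"]) auto
      then show ?thesis using that by (simp add: c form.scaleR_left)
    qed
    have "\<omega> u w = 0" if "\<omega> v u = 0" "\<omega> v w = 0" for u w
    proof -
      have "\<kappa> v * \<omega> u w = \<kappa> v * \<omega> w u"
        using key[OF that] key[OF that(2,1)] second_derivative_sgrad_sym[OF ce(1,2) p', of u w] by metis
      then show ?thesis using \<kappa>v form_skew[of u w] by simp
    qed
    then show False using isotropic_hyperplane_contradiction[OF dim] by blast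
  qed
  then show "J v \<in> tangent_hyperplane \<Sigma> (real_line v)" using T[OF ce(2,3)] unfolding \<kappa>_def by blast
qed

subsection \<open>Hopf tables and complex tangency\<close>

lemma mem_complex_line: "y \<in> complex_line J x \<longleftrightarrow> (\<exists>a b. y = a *\<^sub>R x + b *\<^sub>R J x)"
proof -
  have "{x, J x} = {x} \<union> {J x}" by auto
  then have "complex_line J x = {a + b | a b. a \<in> span {x} \<and> b \<in> span {J x}}"
    unfolding complex_line_def by (simp only: span_Un)
  then show ?thesis by (auto simp: span_singleton)
qed

lemma complex_line_subset:
  assumes "y \<in> complex_line J x"
  shows "complex_line J y \<subseteq> complex_line J x"
proof
  fix z assume "z \<in> complex_line J y"
  then obtain a b c d where "y = a *\<^sub>R x + b *\<^sub>R J x" "z = c *\<^sub>R y + d *\<^sub>R J y"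
    using assms unfolding mem_complex_line by blast
  then have "z = (c * a - d * b) *\<^sub>R x + (c * b + d * a) *\<^sub>R J x"
    by (simp add: J.add J.scaleR algebra_simps)
  then show "z \<in> complex_line J x" unfolding mem_complex_line by blast
qed

text \<open>The conjugate \<open>a - b J\<close> undoes \<open>a + b J\<close> up to the squared
  modulus.\<close>

lemma complex_scale_inverse:
  assumes "y = a *\<^sub>R x + b *\<^sub>R J x"
  shows "(a\<^sup>2 + b\<^sup>2) *\<^sub>R x = a *\<^sub>R y - b *\<^sub>R J y"
  by (simp add: assms J.add J.scaleR algebra_simps power2_eq_square)

lemma complex_line_eq:
  assumes y: "y \<in> complex_line J x" "y \<noteq> 0"
  shows "complex_line J y = complex_line J x"
proof -
  obtain a b where ab: "y = a *\<^sub>R x + b *\<^sub>R J x" using y unfolding mem_complex_line by blast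
  have n: "a\<^sup>2 + b\<^sup>2 \<noteq> 0" using y(2) ab by (auto simp: sum_power2_eq_zero_iff)
  have "(a\<^sup>2 + b\<^sup>2) *\<^sub>R x = a *\<^sub>R y - b *\<^sub>R J y"
    by (rule complex_scale_inverse[OF ab])
  then have "x = inverse (a\<^sup>2 + b\<^sup>2) *\<^sub>R (a *\<^sub>R y - b *\<^sub>R J y)"
    using n by (metis scaleR_scaleR left_inverse scaleR_one)
  then have "x = (a / (a\<^sup>2 + b\<^sup>2)) *\<^sub>R y + (- b / (a\<^sup>2 + b\<^sup>2)) *\<^sub>R J y"
    by (simp add: scaleR_diff_right divide_inverse mult.commute)
  then have "x \<in> complex_line J y" unfolding mem_complex_line by blast
  then show ?thesis using complex_line_subset[OF y(1)] complex_line_subset by blast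
qed

lemma self_mem_complex_line: "x \<in> complex_line J x"
  unfolding complex_line_def by (simp add: span_base)

lemma hopf_map_real_line: "hopf_map J (real_line x) = complex_line J x"
proof -
  have "J ` span {x} = span {J x}" using linear_span_image[OF J.linear, of "{x}"] by simp
  then have "hopf_map J (real_line x) = {a + b | a b. a \<in> span {x} \<and> b \<in> span {J x}}"
    unfolding hopf_map_def real_line_def by (simp only: span_Un span_span)
  then show ?thesis by (auto simp: span_singleton mem_complex_line set_eq_iff)
qed

text \<open>The vectors \<open>v + t J v\<close> all span the complex line of \<open>v\<close> and
  so stay over the table. Hence \<open>F\<close> is constant near \<open>v\<close> along this
  straight line, which serves in place of the circle orbit.\<close>

lemma hopf_table_imp_tangent_J:
  assumes tab: "table \<Sigma>" and hopf: "hopf_table J \<Sigma>"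
  shows "tangent_J \<Sigma>"
  unfolding tangent_J_def
proof (intro allI impI)
  fix v :: 'a assume v: "v \<noteq> 0" "real_line v \<in> \<Sigma>"
  obtain \<Gamma> where \<Gamma>: "\<Sigma> = {L \<in> quot_space real_line. hopf_map J L \<in> \<Gamma>}"
    using hopf unfolding hopf_table_def by blast
  obtain N F where ce: "cone_equation \<Sigma> N F" "v \<in> N" "F v = 0"
    and T: "\<And>x. x \<in> N \<Longrightarrow> F x = 0 \<Longrightarrow> tangent_hyperplane \<Sigma> (real_line x) = {w. \<omega> (sgrad F x) w = 0}"
    using table_sgrad[OF tab v] by metis
  have oN: "open N" using ce unfolding cone_equation_def by blast
  have "isCont (\<lambda>t. v + t *\<^sub>R J v) 0" by (intro continuous_intros)
  then have "((\<lambda>t. v + t *\<^sub>R J v) \<longlongrightarrow> v) (nhds 0)"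
    unfolding isCont_def using tendsto_at_iff_tendsto_nhds[of "\<lambda>t. v + t *\<^sub>R J v" 0] by simp
  then have "\<forall>\<^sub>F t in nhds 0. v + t *\<^sub>R J v \<in> N" using topological_tendstoD oN ce(2) by blast
  then have "\<forall>\<^sub>F t in nhds 0. F (v + t *\<^sub>R J v) = F v"
  proof eventually_elim
    case (elim t)
    have n0: "v + t *\<^sub>R J v \<noteq> 0" using elim ce(1) unfolding cone_equation_def by blast
    moreover have "v + t *\<^sub>R J v \<in> complex_line J v"
      unfolding mem_complex_line by (intro exI[of _ 1] exI[of _ t]) simp
    ultimately have "complex_line J (v + t *\<^sub>R J v) = complex_line J v" by (intro complex_line_eq)
    then have "real_line (v + t *\<^sub>R J v) \<in> \<Sigma>"
      using v n0 unfolding \<Gamma> quot_space_def by (auto simp: hopf_map_real_line)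
    then show ?case using elim ce unfolding cone_equation_def by metis
  qed
  then have "frechet_derivative F (at v) (J v) = 0"
    using directional_derivative_zero cone_equation_has_derivative[OF ce(1,2)] by blast
  then show "J v \<in> tangent_hyperplane \<Sigma> (real_line v)"
    using T[OF ce(2,3)] form_sgrad[OF ce(1,2)] by simp
qed

section \<open>The circle action \<open>exp (t J)\<close>\<close>

definition rot :: "real \<Rightarrow> 'a \<Rightarrow> 'a" where
  "rot t x = cos t *\<^sub>R x + sin t *\<^sub>R J x"

lemma rot_0 [simp]: "rot 0 x = x"
  by (simp add: rot_def)

lemma rot_rot: "rot s (rot t x) = rot (s + t) x"
  by (simp add: rot_def J.add J.scaleR cos_add sin_add algebra_simps)

lemma rot_nonzero: "x \<noteq> 0 \<Longrightarrow> rot t x \<noteq> 0"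
  using rot_rot[of "-t" t x] by (auto simp: rot_def J.zero)

lemma rot_has_vector_derivative: "((\<lambda>t. rot t x) has_vector_derivative J (rot t x)) (at t)"
  unfolding rot_def by (auto intro!: derivative_eq_intros simp: J.add J.scaleR)

lemma continuous_on_rot:
  fixes S :: "'b::t2_space set"
  shows "continuous_on S f \<Longrightarrow> continuous_on S g \<Longrightarrow> continuous_on S (\<lambda>x. rot (f x) (g x))"
  unfolding rot_def by (intro continuous_intros J.continuous_on)

lemma rot_add_scaleR: "rot t (v + s *\<^sub>R u) = rot t v + s *\<^sub>R rot t u"
  by (simp add: rot_def J.add J.scaleR algebra_simps)

text \<open>In the family \<open>F (rot t (v + s u))\<close>, with \<open>u\<close> transverse to
  the table, the derivative in \<open>s\<close> is bounded below near the origin, and the derivative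
  in \<open>t\<close> vanishes at zeros by tangency. \<open>zero_set_stationary\<close> then keeps
  the zero at \<open>s = 0\<close>.\<close>

lemma rot_locally_invariant:
  assumes tab: "table \<Sigma>" and tJ: "tangent_J \<Sigma>" and v: "v \<noteq> 0" "real_line v \<in> \<Sigma>"
  shows "\<exists>\<delta>>0. \<forall>t. \<bar>t\<bar> < \<delta> \<longrightarrow> real_line (rot t v) \<in> \<Sigma>"
proof -
  obtain N F where ce: "cone_equation \<Sigma> N F" "v \<in> N" "F v = 0"
    and T: "\<And>x. x \<in> N \<Longrightarrow> F x = 0 \<Longrightarrow> tangent_hyperplane \<Sigma> (real_line x) = {w. \<omega> (sgrad F x) w = 0}"
    using table_sgrad[OF tab v] by metis
  have oN: "open N" using ce unfolding cone_equation_def by blast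
  obtain u0 where u0: "frechet_derivative F (at v) u0 \<noteq> 0" using ce unfolding cone_equation_def by blast
  define u where "u = frechet_derivative F (at v) u0 *\<^sub>R u0"
  have u: "\<omega> (sgrad F v) u > 0"
    using u0 by (simp add: form_sgrad[OF ce(1,2)] u_def linear_scale[OF cone_equation_linear[OF ce(1,2)]]
        flip: power2_eq_square)
  define c where "c = \<omega> (sgrad F v) u / 2"
  have c: "c > 0" "c < \<omega> (sgrad F v) u" using u by (auto simp: c_def)
  define Q where "Q = (\<lambda>z::real\<times>real. rot (fst z) (v + snd z *\<^sub>R u))"
  \<comment> \<open>Where \<open>Q z\<close> lies in \<open>N\<close>, this is the derivative of
    \<open>F (Q z)\<close> in the second coordinate of \<open>z\<close>. By continuity it exceeds
    \<open>c\<close>, half of its value at the origin, nearby.\<close>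
  define h where "h = (\<lambda>z::real\<times>real. \<omega> (sgrad F (Q z)) (rot (fst z) u))"
  have contQ: "isCont Q z" for z
  proof -
    have "continuous_on UNIV Q" unfolding Q_def by (intro continuous_on_rot continuous_intros)
    then show ?thesis by (simp add: continuous_on_eq_continuous_at del: split_paired_All)
  qed
  have Q0: "Q 0 = v" by (simp add: Q_def)
  have "isCont (sgrad F) (Q 0)"
    unfolding Q0 using sgrad_has_derivative[OF ce(1,2)] has_derivative_continuous by blast
  then have "isCont (\<lambda>z. sgrad F (Q z)) 0" using contQ[of 0] isCont_o2 by blast
  moreover have "isCont (\<lambda>z::real\<times>real. rot (fst z) u) 0"
  proof -
    have "continuous_on UNIV (\<lambda>z::real\<times>real. rot (fst z) u)" by (intro continuous_on_rot continuous_intros)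
    then show ?thesis by (simp add: continuous_on_eq_continuous_at del: split_paired_All)
  qed
  ultimately have "isCont h 0" unfolding h_def by (rule form.isCont)
  then have "\<forall>\<^sub>F z in at 0. c < h z"
    unfolding isCont_def using c by (intro order_tendstoD) (auto simp: h_def Q0)
  moreover have "\<forall>\<^sub>F z in at 0. Q z \<in> N"
    using contQ[of 0] oN ce(2) unfolding isCont_def Q0 by (rule topological_tendstoD)
  ultimately have "\<forall>\<^sub>F z in at 0. c < h z \<and> Q z \<in> N" by eventually_elim auto
  then obtain d where d: "d > 0" "\<And>z. z \<noteq> 0 \<Longrightarrow> dist z 0 < d \<Longrightarrow> c < h z \<and> Q z \<in> N"
    unfolding eventually_at by blast
  define \<epsilon> where "\<epsilon> = d / 3"
  have \<epsilon>: "\<epsilon> > 0" using d by (simp add: \<epsilon>_def)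
  have near: "c < h (t, s)" "rot t (v + s *\<^sub>R u) \<in> N" if "\<bar>t\<bar> \<le> \<epsilon>" "\<bar>s\<bar> \<le> \<epsilon>" for t s
  proof -
    have "norm (t, s) \<le> norm t + norm s" by (rule norm_Pair_le)
    then have "dist (t, s) 0 < d" using that \<epsilon> by (simp add: \<epsilon>_def)
    then have "c < h (t, s) \<and> Q (t, s) \<in> N"
      using d(2)[of "(t, s)"] c ce(2) by (cases "(t, s) = 0") (auto simp: h_def Q0)
    then show "c < h (t, s)" "rot t (v + s *\<^sub>R u) \<in> N" by (auto simp: Q_def)
  qed
  define \<Phi> where "\<Phi> = (\<lambda>t s. F (rot t (v + s *\<^sub>R u)))"
  have ds: "(\<Phi> t has_real_derivative h (t, s)) (at s)" if "\<bar>t\<bar> \<le> \<epsilon>" "\<bar>s\<bar> \<le> \<epsilon>" for t s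
  proof -
    have "((\<lambda>s. F (rot t (v + s *\<^sub>R u))) has_derivative
        (\<lambda>k. frechet_derivative F (at (rot t (v + s *\<^sub>R u))) (k *\<^sub>R rot t u))) (at s)"
      by (rule has_derivative_compose[where x = s and f = "\<lambda>s. rot t (v + s *\<^sub>R u)",
            OF _ cone_equation_has_derivative[OF ce(1) near(2)[OF that]]])
        (auto simp: rot_add_scaleR intro!: derivative_eq_intros)
    then show ?thesis
      unfolding has_field_derivative_def \<Phi>_def h_def Q_def
      by (simp add: linear_scale[OF cone_equation_linear[OF ce(1) near(2)[OF that]]]
          form_sgrad[OF ce(1) near(2)[OF that]] mult.commute[of _ "frechet_derivative _ _ _"])
  qed
  have dt: "((\<lambda>t. \<Phi> t s) has_real_derivative \<omega> (sgrad F (rot t (v + s *\<^sub>R u))) (J (rot t (v + s *\<^sub>R u)))) (at t)"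
    if "\<bar>t\<bar> \<le> \<epsilon>" "\<bar>s\<bar> \<le> \<epsilon>" for t s
  proof -
    have "((\<lambda>t. F (rot t (v + s *\<^sub>R u))) has_derivative
        (\<lambda>k. frechet_derivative F (at (rot t (v + s *\<^sub>R u))) (k *\<^sub>R J (rot t (v + s *\<^sub>R u))))) (at t)"
      using rot_has_vector_derivative[of "v + s *\<^sub>R u" t] unfolding has_vector_derivative_def
      by (rule has_derivative_compose[where x = t and f = "\<lambda>t. rot t (v + s *\<^sub>R u)",
            OF _ cone_equation_has_derivative[OF ce(1) near(2)[OF that]]])
    then show ?thesis
      unfolding has_field_derivative_def \<Phi>_def
      by (simp add: linear_scale[OF cone_equation_linear[OF ce(1) near(2)[OF that]]]
          form_sgrad[OF ce(1) near(2)[OF that]] mult.commute[of _ "frechet_derivative _ _ _"])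
  qed
  have dt0: "((\<lambda>t. \<Phi> t s) has_real_derivative 0) (at t)"
    if "\<bar>t\<bar> \<le> \<epsilon>" "\<bar>s\<bar> \<le> \<epsilon>" "\<Phi> t s = 0" for t s
  proof -
    let ?y = "rot t (v + s *\<^sub>R u)"
    have y: "?y \<in> N" "F ?y = 0" using near that by (auto simp: \<Phi>_def)
    then have "?y \<noteq> 0" "real_line ?y \<in> \<Sigma>" using ce(1) unfolding cone_equation_def by blast+
    then have "\<omega> (sgrad F ?y) (J ?y) = 0" using tJ T[OF y] unfolding tangent_J_def by blast
    then show ?thesis using dt[OF that(1,2)] by simp
  qed
  have "\<exists>\<delta>>0. \<forall>t. \<bar>t\<bar> < \<delta> \<longrightarrow> \<Phi> t 0 = 0"
  proof (rule zero_set_stationary[OF \<epsilon> c(1) ds _ dt0])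
    show "h (t, s) \<ge> c" if "\<bar>t\<bar> \<le> \<epsilon>" "\<bar>s\<bar> \<le> \<epsilon>" for t s using near(1)[OF that] by simp
    show "isCont (\<lambda>t. \<Phi> t s) 0" if "\<bar>s\<bar> \<le> \<epsilon>" for s
      using DERIV_isCont[OF dt[OF _ that]] \<epsilon> by simp
    show "\<Phi> 0 0 = 0" using ce(3) by (simp add: \<Phi>_def)
  qed
  then obtain \<delta> where \<delta>: "\<delta> > 0" "\<And>t. \<bar>t\<bar> < \<delta> \<Longrightarrow> \<Phi> t 0 = 0" by blast
  have "real_line (rot t v) \<in> \<Sigma>" if "\<bar>t\<bar> < min \<delta> \<epsilon>" for t
  proof -
    have "rot t v \<in> N" "F (rot t v) = 0" using near(2)[of t 0] \<delta>(2)[of t] \<epsilon> that by (auto simp: \<Phi>_def)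
    then show ?thesis using ce(1) unfolding cone_equation_def by blast
  qed
  then show ?thesis using \<delta> \<epsilon> by (intro exI[of _ "min \<delta> \<epsilon>"]) auto
qed

text \<open>The times at which the orbit lies over the table form an open set, by local invariance
  at each point of the orbit, and a closed set, because the table is closed. The real line is
  connected.\<close>

lemma rot_invariant:
  assumes tab: "table \<Sigma>" and tJ: "tangent_J \<Sigma>" and v: "v \<noteq> 0" "real_line v \<in> \<Sigma>"
  shows "real_line (rot t v) \<in> \<Sigma>"
proof -
  define B where "B = {t. real_line (rot t v) \<in> \<Sigma>}"
  have "open B"
    unfolding open_dist
  proof
    fix t assume "t \<in> B"
    then obtain \<delta> where \<delta>: "\<delta> > 0" "\<And>s. \<bar>s\<bar> < \<delta> \<Longrightarrow> real_line (rot s (rot t v)) \<in> \<Sigma>"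
      using rot_locally_invariant[OF tab tJ rot_nonzero[OF v(1)]] unfolding B_def by blast
    have "s \<in> B" if "dist s t < \<delta>" for s
      using \<delta>(2)[of "s - t"] that by (simp add: B_def rot_rot dist_real_def)
    then show "\<exists>e>0. \<forall>y. dist y t < e \<longrightarrow> y \<in> B" using \<delta> by blast
  qed
  moreover have "closed B"
  proof -
    have o: "open (cone_over real_line (quot_space real_line - \<Sigma>))"
      using tab unfolding table_def hypersurface_def quot_open_def by blast
    have "- B = (\<lambda>t. rot t v) -` cone_over real_line (quot_space real_line - \<Sigma>)"
      using rot_nonzero[OF v(1)] by (auto simp: B_def cone_over_def quot_space_def)
    moreover have "continuous_on UNIV (\<lambda>t. rot t v)" by (intro continuous_on_rot continuous_intros)
    ultimately show ?thesis using open_vimage[OF o] by (simp add: closed_def)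
  qed
  moreover have "0 \<in> B" using v by (simp add: B_def)
  ultimately have "B = UNIV" using clopen[of B] by blast
  then show ?thesis unfolding B_def by blast
qed

text \<open>In polar form, \<open>a + b J\<close> is a real factor times a rotation.\<close>

lemma complex_line_invariant:
  assumes tab: "table \<Sigma>" and tJ: "tangent_J \<Sigma>" and v: "v \<noteq> 0" "real_line v \<in> \<Sigma>"
    and w: "w \<in> complex_line J v" "w \<noteq> 0"
  shows "real_line w \<in> \<Sigma>"
proof -
  obtain a b where ab: "w = a *\<^sub>R v + b *\<^sub>R J v" using w unfolding mem_complex_line by blast
  obtain r t where "a = r * cos t" "b = r * sin t" using polar_Ex by blast
  then have wr: "w = r *\<^sub>R rot t v" by (simp add: ab rot_def scaleR_add_right)
  then have "r \<noteq> 0" using w(2) by auto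
  then show ?thesis using rot_invariant[OF tab tJ v] wr real_line_scale by metis
qed

text \<open>\<open>slice v z\<close> spans the same complex line as \<open>z\<close> (unless it vanishes) and, up to a real factor, is
  the point of that line in the slice \<open>\<omega> y v = 0\<close>. Being quadratic it needs no division, and functions on
  the real projective space do not see the factor.\<close>

definition slice :: "'a \<Rightarrow> 'a \<Rightarrow> 'a" where
  "slice v z = \<omega> z (J v) *\<^sub>R z + \<omega> z v *\<^sub>R J z"

text \<open>Because complex scaling only contributes a real factor, \<open>slice v\<close> induces a
  map from complex lines to real lines wherever it does not vanish.\<close>

lemma slice_complex_scale: "slice v (a *\<^sub>R z + b *\<^sub>R J z) = (a\<^sup>2 + b\<^sup>2) *\<^sub>R slice v z"
  by (simp add: slice_def form.add_left form.scaleR_left form_J_left form.minus_right J.add J.scaleR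
      algebra_simps power2_eq_square)

lemma form_slice: "\<omega> (slice v z) (J v) = (\<omega> z (J v))\<^sup>2 + (\<omega> z v)\<^sup>2" "\<omega> (slice v z) v = 0"
  by (simp_all add: slice_def form.add_left form.scaleR_left form_J_left[of z v] power2_eq_square)

lemma slice_fixed: "\<omega> y v = 0 \<Longrightarrow> slice v y = \<omega> y (J v) *\<^sub>R y"
  by (simp add: slice_def)

lemma slice_zero [simp]: "slice v 0 = 0"
  by (simp add: slice_def J.zero)

lemma Ck_on_slice: "open S \<Longrightarrow> Ck_on k S (slice v)"
  unfolding slice_def
  by (intro Ck_on_add Ck_on_bilinear[OF bounded_bilinear_scaleR] Ck_on_bounded_linear[OF J.bounded_linear_axioms]
      Ck_on_bounded_linear[OF form.bounded_linear_left] Ck_on_ident)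

text \<open>Near the complex line of \<open>v0\<close> an equation is \<open>F\<close> composed with
  \<open>slice v0\<close>; it descends because \<open>F\<close> ignores real factors. Its
  differential is nonzero because that of \<open>F\<close> kills \<open>y\<close> and
  \<open>J y\<close>, so a direction on which it does not vanish can be moved into the slice and
  then lifted through \<open>slice v0\<close>.\<close>

lemma tangent_J_hypersurface:
  assumes tab: "table \<Sigma>" and tJ: "tangent_J \<Sigma>"
  shows "hypersurface (complex_line J) (complex_line J ` {v. v \<noteq> 0 \<and> real_line v \<in> \<Sigma>})"
    (is "hypersurface _ ?\<Gamma>")
proof -
  have \<Gamma>_iff: "complex_line J x \<in> ?\<Gamma> \<longleftrightarrow> real_line x \<in> \<Sigma>" if "x \<noteq> 0" for x
  proof
    assume "complex_line J x \<in> ?\<Gamma>"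
    then obtain v where "complex_line J x = complex_line J v" "v \<noteq> 0" "real_line v \<in> \<Sigma>" by auto
    then show "real_line x \<in> \<Sigma>"
      using complex_line_invariant[OF tab tJ] self_mem_complex_line that by metis
  qed (use that in auto)
  have 1: "?\<Gamma> \<subseteq> quot_space (complex_line J)" by (auto simp: quot_space_def)
  have "cone_over (complex_line J) (quot_space (complex_line J) - ?\<Gamma>)
      = cone_over real_line (quot_space real_line - \<Sigma>)"
    unfolding cone_over_def using \<Gamma>_iff by (auto simp: quot_space_def)
  then have 2: "quot_open (complex_line J) (quot_space (complex_line J) - ?\<Gamma>)"
    using tab unfolding table_def hypersurface_def quot_open_def by auto
  have 3: "\<exists>U f. p \<in> U \<and> local_equation (complex_line J) ?\<Gamma> U f" if p: "p \<in> ?\<Gamma>" for p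
  proof -
    obtain v0 where v0: "p = complex_line J v0" "v0 \<noteq> 0" "real_line v0 \<in> \<Sigma>" using p by auto
    obtain N F where ce: "cone_equation \<Sigma> N F" "v0 \<in> N" "F v0 = 0"
      and T: "\<And>x. x \<in> N \<Longrightarrow> F x = 0 \<Longrightarrow> tangent_hyperplane \<Sigma> (real_line x) = {w. \<omega> (sgrad F x) w = 0}"
      using table_sgrad[OF tab v0(2,3)] by metis
    have oN: "open N" and N0: "0 \<notin> N"
      and Nscale: "\<And>x t. x \<in> N \<Longrightarrow> t \<noteq> 0 \<Longrightarrow> t *\<^sub>R x \<in> N \<and> F (t *\<^sub>R x) = F x"
      and F_iff: "\<And>x. x \<in> N \<Longrightarrow> real_line x \<in> \<Sigma> \<longleftrightarrow> F x = 0"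
      using ce(1) unfolding cone_equation_def by blast+
    define M where "M = slice v0 -` N"
    define U where "U = complex_line J ` M"
    \<comment> \<open>The choice of a representative is immaterial on \<open>U\<close>, as
      \<open>Mscale\<close> shows.\<close>
    define f where "f = (\<lambda>q. F (slice v0 (SOME z. z \<noteq> 0 \<and> complex_line J z = q)))"
    have M0: "z \<noteq> 0" if "z \<in> M" for z using that N0 by (auto simp: M_def)
    have Mscale: "y \<in> M \<and> F (slice v0 y) = F (slice v0 x)"
      if x: "x \<in> M" and y: "y \<noteq> 0" "complex_line J y = complex_line J x" for x y
    proof -
      obtain a b where ab: "y = a *\<^sub>R x + b *\<^sub>R J x"
        using self_mem_complex_line[of y] unfolding y(2) mem_complex_line by blast
      then have n: "a\<^sup>2 + b\<^sup>2 \<noteq> 0" using y(1) by (auto simp: sum_power2_eq_zero_iff)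
      then show ?thesis using Nscale[OF _ n] x by (simp add: M_def ab slice_complex_scale)
    qed
    have cone: "cone_over (complex_line J) U = M"
      using Mscale M0 by (auto simp: cone_over_def U_def)
    have f: "f (complex_line J x) = F (slice v0 x)" if "x \<in> M" for x
    proof -
      have "\<exists>z. z \<noteq> 0 \<and> complex_line J z = complex_line J x" using M0[OF that] by blast
      from someI_ex[OF this] show ?thesis using Mscale[OF that] unfolding f_def by blast
    qed
    have "continuous_on UNIV (slice v0)" using Ck_on_slice[of UNIV 0 v0] by simp
    then have oM: "open M" unfolding M_def using oN by (rule open_vimage[rotated])
    have CkM: "Ck_on k M (\<lambda>x. f (complex_line J x))" for k
    proof (rule Ck_on_cong[OF oM])
      show "Ck_on k M (\<lambda>x. F (slice v0 x))"
        using ce(1) unfolding cone_equation_def smooth_on_def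
        by (intro Ck_on_compose[OF oM oN _ Ck_on_slice[OF oM]]) (auto simp: M_def)
    qed (simp add: f)
    have slice_real: "real_line (slice v0 x) \<in> \<Sigma> \<longleftrightarrow> real_line x \<in> \<Sigma>" if x: "x \<in> M" for x
    proof -
      have s0: "slice v0 x \<noteq> 0" using x N0 by (auto simp: M_def)
      have "slice v0 x \<in> complex_line J x" unfolding slice_def mem_complex_line by blast
      then have "complex_line J (slice v0 x) = complex_line J x" using s0 by (rule complex_line_eq)
      then show ?thesis using \<Gamma>_iff[OF s0] \<Gamma>_iff[OF M0[OF x]] by simp
    qed
    have zero: "q \<in> ?\<Gamma> \<longleftrightarrow> f q = 0" if q: "q \<in> U" for q
    proof -
      obtain x where x: "x \<in> M" "q = complex_line J x" using q by (auto simp: U_def)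
      have "slice v0 x \<in> N" using x by (simp add: M_def)
      then show ?thesis
        using \<Gamma>_iff[OF M0[OF x(1)]] slice_real[OF x(1)] F_iff f[OF x(1)] x(2) by simp
    qed
    have deriv: "\<exists>w. frechet_derivative (\<lambda>x. f (complex_line J x)) (at v) w \<noteq> 0"
      if v: "v \<in> cone_over (complex_line J) (?\<Gamma> \<inter> U)" for v
    proof -
      have vM: "v \<in> M" using v cone by (auto simp: cone_over_def)
      have "complex_line J v \<in> ?\<Gamma>" using v by (auto simp: cone_over_def)
      then have vS: "real_line v \<in> \<Sigma>" using \<Gamma>_iff M0[OF vM] by blast
      \<comment> \<open>\<open>slice v0\<close> multiplies \<open>v\<close> by the complex number
        \<open>A + B J\<close>, whose squared modulus is \<open>r\<close>.\<close>
      define A B r where "A = \<omega> v (J v0)" and "B = \<omega> v v0" and "r = A\<^sup>2 + B\<^sup>2"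
      define y where "y = slice v0 v"
      have y: "y \<in> N" "y \<noteq> 0" "real_line y \<in> \<Sigma>" "F y = 0"
        using vM N0 slice_real[OF vM] vS F_iff by (auto simp: M_def y_def)
      have yr: "\<omega> y (J v0) = r" "\<omega> y v0 = 0" by (simp_all add: y_def form_slice r_def A_def B_def)
      have r: "r \<noteq> 0"
      proof
        assume "r = 0"
        then have "A = 0" "B = 0" by (simp_all add: r_def sum_power2_eq_zero_iff)
        then show False using y(2) by (simp add: y_def slice_def A_def B_def)
      qed
      define D where "D = frechet_derivative F (at y)"
      have linD: "linear D" unfolding D_def by (rule cone_equation_linear[OF ce(1) y(1)])
      have Dy: "D y = 0" unfolding D_def by (rule cone_equation_euler[OF ce(1) y(1)])
      have DJy: "D (J y) = 0"
        using tJ y T[OF y(1,4)] form_sgrad[OF ce(1) y(1)] unfolding tangent_J_def D_def by auto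
      obtain w0 where w0: "D w0 \<noteq> 0" using ce(1) y(1,4) unfolding cone_equation_def D_def by blast
      \<comment> \<open>Multiples of \<open>y\<close> and \<open>J y\<close>, which \<open>D\<close>
        kills, move \<open>w0\<close> into the complex orthogonal complement of \<open>v0\<close>
        without changing the value of \<open>D\<close>.\<close>
      define w where "w = w0 - (\<omega> w0 (J v0) / r) *\<^sub>R y + (\<omega> w0 v0 / r) *\<^sub>R J y"
      have w: "\<omega> w (J v0) = 0" "\<omega> w v0 = 0"
        using r yr by (simp_all add: w_def form.add_left form.diff_left form.scaleR_left form_J_left[of y v0])
      have Dw: "D w = D w0"
        by (simp add: w_def linear_add[OF linD] linear_diff[OF linD] linear_scale[OF linD] Dy DJy)
      \<comment> \<open>\<open>w'\<close> is \<open>w\<close> divided by \<open>A + B J\<close>.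
        Multiplication by that number sends \<open>v + t w'\<close> to \<open>y + t w\<close>, which
        already lies in the slice.\<close>
      define w' where "w' = inverse r *\<^sub>R (A *\<^sub>R w - B *\<^sub>R J w)"
      have slice_line: "slice v0 (v + t *\<^sub>R w') = y + t *\<^sub>R w" for t
      proof -
        have w'w: "A *\<^sub>R w' + B *\<^sub>R J w' = w"
        proof -
          have "A *\<^sub>R w' + B *\<^sub>R J w' = inverse r *\<^sub>R (r *\<^sub>R w)"
            by (simp add: w'_def r_def J.scaleR J.diff algebra_simps power2_eq_square)
          then show ?thesis using r by simp
        qed
        have "A *\<^sub>R (v + t *\<^sub>R w') + B *\<^sub>R J (v + t *\<^sub>R w') = y + t *\<^sub>R (A *\<^sub>R w' + B *\<^sub>R J w')"
          by (simp add: y_def slice_def A_def B_def J.add J.scaleR algebra_simps)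
        then have "r *\<^sub>R slice v0 (v + t *\<^sub>R w') = slice v0 (y + t *\<^sub>R w)"
          unfolding w'w r_def by (metis slice_complex_scale)
        also have "\<dots> = r *\<^sub>R (y + t *\<^sub>R w)"
          using slice_fixed[of "y + t *\<^sub>R w" v0] yr w by (simp add: form.add_left form.scaleR_left)
        finally show ?thesis using r by simp
      qed
      let ?f = "\<lambda>x. f (complex_line J x)"
      have "((\<lambda>t. ?f (v + t *\<^sub>R w')) has_derivative (\<lambda>h. frechet_derivative ?f (at v) (h *\<^sub>R w'))) (at 0)"
        using Ck_on_has_derivative[OF CkM vM]
        by (intro has_derivative_compose[of "\<lambda>t. v + t *\<^sub>R w'" _ 0 UNIV ?f])
          (auto intro!: derivative_eq_intros)
      moreover have "((\<lambda>t. ?f (v + t *\<^sub>R w')) has_derivative (\<lambda>h. D (h *\<^sub>R w))) (at 0)"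
      proof (rule has_derivative_transform_within_open)
        show "((\<lambda>t. F (y + t *\<^sub>R w)) has_derivative (\<lambda>h. D (h *\<^sub>R w))) (at 0)"
          using cone_equation_has_derivative[OF ce(1) y(1)] unfolding D_def
          by (intro has_derivative_compose[of "\<lambda>t. y + t *\<^sub>R w" _ 0 UNIV F])
            (auto intro!: derivative_eq_intros)
        show "open ((\<lambda>t. v + t *\<^sub>R w') -` M)"
          using oM by (intro open_vimage continuous_intros)
        show "F (y + t *\<^sub>R w) = ?f (v + t *\<^sub>R w')" if "t \<in> (\<lambda>t. v + t *\<^sub>R w') -` M" for t
          using f that by (simp add: slice_line)
      qed (use vM in simp)
      ultimately have "(\<lambda>h. frechet_derivative ?f (at v) (h *\<^sub>R w')) = (\<lambda>h. D (h *\<^sub>R w))"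
        by (rule has_derivative_unique)
      then have "frechet_derivative ?f (at v) (1 *\<^sub>R w') = D (1 *\<^sub>R w)" by (rule fun_cong)
      then show ?thesis using w0 Dw by (intro exI[of _ w']) simp
    qed
    have "slice v0 v0 = \<omega> v0 (J v0) *\<^sub>R v0" by (simp add: slice_def)
    then have "v0 \<in> M" using Nscale[OF ce(2)] form_J_pos[OF v0(2)] by (simp add: M_def)
    then have "p \<in> U" using v0(1) by (simp add: U_def)
    moreover have "local_equation (complex_line J) ?\<Gamma> U f"
      unfolding local_equation_def
    proof (intro conjI ballI)
      show "quot_open (complex_line J) U"
        unfolding quot_open_def cone using oM M0 by (auto simp: U_def quot_space_def)
      show "smooth_on (cone_over (complex_line J) U) (\<lambda>v. f (complex_line J v))"
        unfolding cone smooth_on_def using CkM by blast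
    qed (use zero deriv in blast)+
    ultimately show ?thesis by blast
  qed
  show ?thesis unfolding hypersurface_def using 1 2 3 by blast
qed

lemma tangent_J_imp_hopf_table:
  assumes tab: "table \<Sigma>" and tJ: "tangent_J \<Sigma>"
  shows "hopf_table J \<Sigma>"
proof -
  let ?\<Gamma> = "complex_line J ` {v. v \<noteq> 0 \<and> real_line v \<in> \<Sigma>}"
  have "L \<in> \<Sigma> \<longleftrightarrow> L \<in> quot_space real_line \<and> hopf_map J L \<in> ?\<Gamma>" for L
  proof
    assume "L \<in> \<Sigma>"
    then obtain x where "L = real_line x" "x \<noteq> 0"
      using tab unfolding table_def hypersurface_def quot_space_def by auto
    then show "L \<in> quot_space real_line \<and> hopf_map J L \<in> ?\<Gamma>"
      using \<open>L \<in> \<Sigma>\<close> by (auto simp: quot_space_def hopf_map_real_line)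
  next
    assume L: "L \<in> quot_space real_line \<and> hopf_map J L \<in> ?\<Gamma>"
    then obtain x where x: "L = real_line x" "x \<noteq> 0" unfolding quot_space_def by blast
    with L obtain v where "complex_line J x = complex_line J v" "v \<noteq> 0" "real_line v \<in> \<Sigma>"
      by (auto simp: hopf_map_real_line)
    with x show "L \<in> \<Sigma>"
      using complex_line_invariant[OF tab tJ] self_mem_complex_line by metis
  qed
  then show ?thesis
    unfolding hopf_table_def using tangent_J_hypersurface[OF tab tJ] by blast
qed

end

section \<open>The contact form of the reflection\<close>

text \<open>A local diffeomorphism of the angle rule seen on vectors: \<open>K\<close> lifts the
  choice of the foot on the table, and one equation \<open>F\<close> serves all the feet.
  \<open>M\<close> need not be a cone, and no homogeneity of \<open>K\<close> is assumed.\<close>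

locale reflection_lift = compatible_symplectic \<omega> J
  for \<omega> :: "'a::euclidean_space \<Rightarrow> 'a \<Rightarrow> real" and J :: "'a \<Rightarrow> 'a" +
  fixes \<Sigma> :: "'a set set" and N :: "'a set" and F :: "'a \<Rightarrow> real"
    and M :: "'a set" and K :: "'a \<Rightarrow> 'a" and \<phi> :: "'a set \<Rightarrow> 'a set"
  assumes equation: "cone_equation \<Sigma> N F"
    and open_dom: "open M"
    and foot_differentiable: "x \<in> M \<Longrightarrow> K differentiable (at x)"
    and foot_on_table: "x \<in> M \<Longrightarrow> K x \<in> N \<and> F (K x) = 0"
    and foot_ne_polar: "x \<in> M \<Longrightarrow> real_line (sgrad F (K x)) \<noteq> real_line (K x)"
    and on_characteristic: "x \<in> M \<Longrightarrow> \<exists>\<alpha> \<beta>. x = \<alpha> *\<^sub>R K x + \<beta> *\<^sub>R sgrad F (K x)"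
    and reflects: "x \<in> M \<Longrightarrow> x \<noteq> 0 \<and> \<phi> (real_line x) = real_line (line_reflection (g_J \<omega> J) (K x) x)"
begin

abbreviation dK :: "'a \<Rightarrow> 'a \<Rightarrow> 'a" where
  "dK x \<equiv> frechet_derivative K (at x)"

abbreviation polar :: "'a \<Rightarrow> 'a" where
  "polar x \<equiv> sgrad F (K x)"

text \<open>The coefficient of the \<open>g_J\<close>-orthogonal projection of \<open>x\<close> onto
  the line of the foot.\<close>

definition foot_coeff :: "'a \<Rightarrow> real" where
  "foot_coeff x = \<omega> x (J (K x)) / \<omega> (K x) (J (K x))"

section \<open>Differentiated incidence relations\<close>

lemma foot_derivative: "x \<in> M \<Longrightarrow> (K has_derivative dK x) (at x)"
  using foot_differentiable by (simp add: frechet_derivative_works)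

lemma foot_nonzero: "x \<in> M \<Longrightarrow> K x \<noteq> 0"
  using foot_on_table equation unfolding cone_equation_def by blast

lemma polar_nonzero: "x \<in> M \<Longrightarrow> polar x \<noteq> 0"
  using foot_on_table sgrad_nonzero[OF equation] by blast

lemma form_polar_foot: "x \<in> M \<Longrightarrow> \<omega> (polar x) (K x) = 0"
  using foot_on_table form_sgrad_self[OF equation] by blast

lemma derivative_zero_on_dom:
  assumes "x \<in> M" "(f has_derivative f') (at x)" "\<And>y. y \<in> M \<Longrightarrow> f y = (0::real)"
  shows "f' w = 0"
proof -
  have "((\<lambda>y. 0) has_derivative f') (at x)"
    by (rule has_derivative_transform_within_open[OF assms(2) open_dom assms(1,3)])
  then have "f' = (\<lambda>h. 0)" using has_derivative_const has_derivative_unique by blast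
  then show ?thesis by simp
qed

text \<open>The feet stay on the table, so \<open>dK x\<close> takes values in its tangent
  hyperplane.\<close>

lemma form_polar_foot_derivative:
  assumes "x \<in> M" shows "\<omega> (polar x) (dK x w) = 0"
proof -
  have k: "K x \<in> N" using foot_on_table assms by blast
  have "((\<lambda>y. F (K y)) has_derivative (\<lambda>w. frechet_derivative F (at (K x)) (dK x w))) (at x)"
    by (rule has_derivative_compose[OF foot_derivative[OF assms] cone_equation_has_derivative[OF equation k]])
  then have "frechet_derivative F (at (K x)) (dK x w) = 0"
    using derivative_zero_on_dom[OF assms] foot_on_table by blast
  then show ?thesis by (simp add: form_sgrad[OF equation k])
qed

text \<open>The characteristic plane is isotropic because its spanning vectors are
  \<open>\<omega>\<close>-orthogonal.\<close>

lemma form_point_foot: "x \<in> M \<Longrightarrow> \<omega> x (K x) = 0" and form_point_polar: "x \<in> M \<Longrightarrow> \<omega> x (polar x) = 0"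
proof -
  assume x: "x \<in> M"
  obtain \<alpha> \<beta> where ab: "x = \<alpha> *\<^sub>R K x + \<beta> *\<^sub>R polar x" using on_characteristic[OF x] by blast
  have "\<omega> (\<alpha> *\<^sub>R K x + \<beta> *\<^sub>R polar x) (K x) = 0" "\<omega> (\<alpha> *\<^sub>R K x + \<beta> *\<^sub>R polar x) (polar x) = 0"
    using form_polar_foot[OF x] form_skew[of "K x" "polar x"] by (simp_all add: form.add_left form.scaleR_left)
  then show "\<omega> x (K x) = 0" "\<omega> x (polar x) = 0" using ab by simp_all
qed

lemma form_point_foot_derivative:
  assumes x: "x \<in> M" and ab: "x = \<alpha> *\<^sub>R K x + \<beta> *\<^sub>R polar x"
  shows "\<omega> x (dK x w) = - \<alpha> * \<omega> (dK x w) (K x)"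
proof -
  have "\<omega> x (dK x w) = \<omega> (\<alpha> *\<^sub>R K x + \<beta> *\<^sub>R polar x) (dK x w)" using ab by simp
  then show ?thesis
    using form_polar_foot_derivative[OF x] form_skew[of "K x" "dK x w"]
    by (simp add: form.add_left form.scaleR_left)
qed

text \<open>This is the derivative of the isotropy relation \<open>\<omega> y (K y) = 0\<close> in
  the direction \<open>w\<close>.\<close>

lemma form_foot:
  assumes x: "x \<in> M" and ab: "x = \<alpha> *\<^sub>R K x + \<beta> *\<^sub>R polar x"
  shows "\<omega> w (K x) = \<alpha> * \<omega> (dK x w) (K x)"
proof -
  have "((\<lambda>y. \<omega> y (K y)) has_derivative (\<lambda>w. \<omega> x (dK x w) + \<omega> w (K x))) (at x)"
    by (rule form.FDERIV[OF has_derivative_ident foot_derivative[OF x]])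
  then have "\<omega> x (dK x w) + \<omega> w (K x) = 0"
    using derivative_zero_on_dom[OF x] form_point_foot by blast
  then show ?thesis using form_point_foot_derivative[OF x ab, of w] by simp
qed

text \<open>Otherwise \<open>form_foot\<close> would make \<open>K x\<close> orthogonal to
  everything.\<close>

lemma foot_coordinate_nonzero:
  assumes x: "x \<in> M" and ab: "x = \<alpha> *\<^sub>R K x + \<beta> *\<^sub>R polar x"
  shows "\<alpha> \<noteq> 0"
proof
  assume "\<alpha> = 0"
  then have "\<omega> w (K x) = 0" for w using form_foot[OF x ab] by simp
  then have "K x = 0" using form_nondegenerate form_skew[of "K x"] by simp
  then show False using foot_nonzero x by blast
qed

text \<open>If \<open>\<beta>\<close> vanished, \<open>x\<close> would be a multiple of
  \<open>K x\<close>. Differentiating the orthogonality of the polar vector to the foot and to the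
  point would then make \<open>polar x\<close> orthogonal to everything.\<close>

lemma polar_coordinate_nonzero:
  assumes x: "x \<in> M" and ab: "x = \<alpha> *\<^sub>R K x + \<beta> *\<^sub>R polar x"
  shows "\<beta> \<noteq> 0"
proof
  assume b: "\<beta> = 0"
  obtain p' where p': "(sgrad F has_derivative p') (at (K x))"
    using sgrad_has_derivative[OF equation] foot_on_table[OF x] by blast
  have Pd: "(polar has_derivative (\<lambda>w. p' (dK x w))) (at x)"
    by (rule has_derivative_compose[OF foot_derivative[OF x] p'])
  have "\<omega> w (polar x) = 0" for w
  proof -
    have "\<omega> (polar x) (dK x w) + \<omega> (p' (dK x w)) (K x) = 0"
      by (rule derivative_zero_on_dom[OF x form.FDERIV[OF Pd foot_derivative[OF x]] form_polar_foot])
    then have "\<omega> (K x) (p' (dK x w)) = 0"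
      using form_polar_foot_derivative[OF x] form_skew[of "K x"] by simp
    moreover have "\<omega> x (p' (dK x w)) = \<omega> (\<alpha> *\<^sub>R K x) (p' (dK x w))" using ab b by simp
    moreover have "\<omega> x (p' (dK x w)) + \<omega> w (polar x) = 0"
      by (rule derivative_zero_on_dom[OF x form.FDERIV[OF has_derivative_ident Pd] form_point_polar])
    ultimately show ?thesis by (simp add: form.scaleR_left)
  qed
  then have "polar x = 0" using form_nondegenerate form_skew[of "polar x"] by simp
  then show False using polar_nonzero x by blast
qed

lemma foot_coeff_coordinates:
  assumes x: "x \<in> M" and ab: "x = \<alpha> *\<^sub>R K x + \<beta> *\<^sub>R polar x"
  shows "foot_coeff x = \<alpha> + \<beta> * \<omega> (polar x) (J (K x)) / \<omega> (K x) (J (K x))"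
proof -
  have "\<omega> x (J (K x)) = \<omega> (\<alpha> *\<^sub>R K x + \<beta> *\<^sub>R polar x) (J (K x))" using ab by simp
  then show ?thesis
    using form_J_pos[OF foot_nonzero[OF x]]
    by (simp add: foot_coeff_def form.add_left form.scaleR_left add_divide_distrib)
qed

text \<open>A lift \<open>H\<close> of the reflection is \<open>c * (2 * foot_coeff x * K x - x)\<close>; neither the derivative of \<open>c\<close> nor that
  of \<open>foot_coeff\<close> contributes to the contact form.\<close>

lemma reflected_contact_form:
  assumes x: "x \<in> M" and ab: "x = \<alpha> *\<^sub>R K x + \<beta> *\<^sub>R polar x"
    and H: "open M'" "x \<in> M'" "(H has_derivative H') (at x)"
    and lift: "\<And>y. y \<in> M' \<Longrightarrow> H y \<noteq> 0 \<and> \<phi> (real_line y) = real_line (H y)"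
  shows "\<exists>c. c \<noteq> 0 \<and> (\<forall>w. \<omega> (H' w) (H x) = c\<^sup>2 * (\<omega> w x + 4 * foot_coeff x * (foot_coeff x - \<alpha>) * \<omega> (dK x w) (K x)))"
proof -
  define R where "R = (\<lambda>y. (2 * foot_coeff y) *\<^sub>R K y - y)"
  have refl: "line_reflection (g_J \<omega> J) (K y) y = R y" for y
    by (simp add: line_reflection_def g_J_def R_def foot_coeff_def)
  \<comment> \<open>Writing the factor between the two lifts as a quotient of inner products makes
    its differentiability follow from that of \<open>H\<close> and \<open>R\<close>.\<close>
  define c where "c = (\<lambda>y. (H y \<bullet> R y) / (R y \<bullet> R y))"
  have HR: "H y = c y *\<^sub>R R y \<and> c y \<noteq> 0 \<and> R y \<noteq> 0" if "y \<in> M \<inter> M'" for y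
  proof -
    have "real_line (R y) = real_line (H y)" "H y \<noteq> 0" using reflects lift that refl by auto
    then obtain d where d: "H y = d *\<^sub>R R y" using real_line_eqD by blast
    then have "R y \<noteq> 0" "d \<noteq> 0" using \<open>H y \<noteq> 0\<close> by auto
    moreover from this have "c y = d" by (simp add: c_def d)
    ultimately show ?thesis using d by simp
  qed
  have xM: "x \<in> M \<inter> M'" using x H by simp
  have n0: "\<omega> (K x) (J (K x)) \<noteq> 0" using form_J_pos[OF foot_nonzero[OF x]] by simp
  have JK: "((\<lambda>y. J (K y)) has_derivative (\<lambda>w. J (dK x w))) (at x)"
    by (rule J.has_derivative[OF foot_derivative[OF x]])
  obtain s' where s': "(foot_coeff has_derivative s') (at x)"
    unfolding foot_coeff_def[abs_def]
    using has_derivative_divide[OF form.FDERIV[OF has_derivative_ident JK]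
        form.FDERIV[OF foot_derivative[OF x] JK] n0] by blast
  have Rd: "(R has_derivative (\<lambda>w. (2 * foot_coeff x) *\<^sub>R dK x w + (2 * s' w) *\<^sub>R K x - w)) (at x)"
    unfolding R_def
    by (intro has_derivative_diff has_derivative_scaleR has_derivative_mult_right s'
        foot_derivative[OF x] has_derivative_ident)
  obtain c' where c': "(c has_derivative c') (at x)"
    unfolding c_def[abs_def]
    using has_derivative_divide[OF has_derivative_inner[OF H(3) Rd] has_derivative_inner[OF Rd Rd]] HR[OF xM]
    by auto
  have "((\<lambda>y. c y *\<^sub>R R y) has_derivative
      (\<lambda>w. c x *\<^sub>R ((2 * foot_coeff x) *\<^sub>R dK x w + (2 * s' w) *\<^sub>R K x - w) + c' w *\<^sub>R R x)) (at x)"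
    by (rule has_derivative_scaleR[OF c' Rd])
  then have "(H has_derivative
      (\<lambda>w. c x *\<^sub>R ((2 * foot_coeff x) *\<^sub>R dK x w + (2 * s' w) *\<^sub>R K x - w) + c' w *\<^sub>R R x)) (at x)"
    by (rule has_derivative_transform_within_open[OF _ open_Int[OF open_dom H(1)] xM]) (use HR in metis)
  then have H': "H' = (\<lambda>w. c x *\<^sub>R ((2 * foot_coeff x) *\<^sub>R dK x w + (2 * s' w) *\<^sub>R K x - w) + c' w *\<^sub>R R x)"
    by (rule has_derivative_unique[OF H(3)])
  have "\<omega> (H' w) (H x) = (c x)\<^sup>2 * (\<omega> w x + 4 * foot_coeff x * (foot_coeff x - \<alpha>) * \<omega> (dK x w) (K x))" for w
  proof -
    have Hx: "H x = c x *\<^sub>R R x" using HR[OF xM] by blast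
    \<comment> \<open>\<open>c'\<close> disappears because it multiplies
      \<open>\<omega> (R x) (R x)\<close>. Later \<open>s'\<close> disappears because
      \<open>K x\<close> is \<open>\<omega>\<close>-orthogonal to \<open>R x\<close>.\<close>
    have "\<omega> (H' w) (H x) = (c x)\<^sup>2 * \<omega> ((2 * foot_coeff x) *\<^sub>R dK x w + (2 * s' w) *\<^sub>R K x - w) (R x)"
      unfolding H' Hx by (simp add: form.add_left form.scaleR_left form.scaleR_right power2_eq_square)
    moreover have "\<omega> (dK x w) x = \<alpha> * \<omega> (dK x w) (K x)"
      using form_point_foot_derivative[OF x ab, of w] form_skew[of "dK x w" x] by simp
    moreover have "\<omega> (K x) x = 0" using form_point_foot[OF x] form_skew[of "K x" x] by simp
    ultimately show ?thesis
      using form_foot[OF x ab, of w]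
      by (simp add: R_def form.add_left form.diff_left form.scaleR_left form.diff_right form.scaleR_right
          algebra_simps power2_eq_square)
  qed
  then show ?thesis using HR[OF xM] by blast
qed

text \<open>Orthogonality means \<open>foot_coeff x = \<alpha>\<close>, which removes the extra term
  of the contact form.\<close>

lemma tangent_preserves_contact:
  assumes x: "x \<in> M" and o: "\<omega> (polar x) (J (K x)) = 0"
    and H: "open M'" "x \<in> M'" "(H has_derivative H') (at x)"
    and lift: "\<And>y. y \<in> M' \<Longrightarrow> H y \<noteq> 0 \<and> \<phi> (real_line y) = real_line (H y)"
  shows "\<omega> (H' w) (H x) = 0 \<longleftrightarrow> \<omega> w x = 0"
proof -
  obtain \<alpha> \<beta> where ab: "x = \<alpha> *\<^sub>R K x + \<beta> *\<^sub>R polar x" using on_characteristic[OF x] by blast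
  have "foot_coeff x = \<alpha>" using foot_coeff_coordinates[OF x ab] o by simp
  then show ?thesis using reflected_contact_form[OF x ab H lift] by auto
qed

text \<open>By \<open>form_foot\<close> the pulled back form is a nonzero multiple of
  \<open>\<omega> w x + k * \<omega> w (K x)\<close>. If its kernel is that of
  \<open>\<omega> w x\<close>, then \<open>k K x\<close> is a multiple of \<open>x\<close>. As
  \<open>x\<close> has a nonzero polar coordinate and the polar line differs from the line of the
  foot, \<open>k\<close> is zero.\<close>

lemma contact_imp_stationary_or_orthogonal:
  assumes x: "x \<in> M"
    and H: "open M'" "x \<in> M'" "(H has_derivative H') (at x)"
    and lift: "\<And>y. y \<in> M' \<Longrightarrow> H y \<noteq> 0 \<and> \<phi> (real_line y) = real_line (H y)"
    and contact: "\<And>w. \<omega> (H' w) (H x) = 0 \<longleftrightarrow> \<omega> w x = 0"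
  shows "foot_coeff x = 0 \<or> \<omega> (polar x) (J (K x)) = 0"
proof -
  obtain \<alpha> \<beta> where ab: "x = \<alpha> *\<^sub>R K x + \<beta> *\<^sub>R polar x" using on_characteristic[OF x] by blast
  note a0 = foot_coordinate_nonzero[OF x ab] and b0 = polar_coordinate_nonzero[OF x ab]
  define k where "k = 4 * foot_coeff x * (foot_coeff x - \<alpha>) / \<alpha>"
  obtain c where "c \<noteq> 0"
    and c: "\<And>w. \<omega> (H' w) (H x) = c\<^sup>2 * (\<omega> w x + 4 * foot_coeff x * (foot_coeff x - \<alpha>) * \<omega> (dK x w) (K x))"
    using reflected_contact_form[OF x ab H lift] by blast
  have c': "\<omega> w x = 0 \<longleftrightarrow> \<omega> w x + k * \<omega> w (K x) = 0" for w
  proof -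
    have "k * \<omega> w (K x) = 4 * foot_coeff x * (foot_coeff x - \<alpha>) * \<omega> (dK x w) (K x)"
      using a0 by (simp add: k_def form_foot[OF x ab, of w])
    then show ?thesis using contact[of w] c[of w] \<open>c \<noteq> 0\<close> by simp
  qed
  have "\<omega> (k *\<^sub>R K x) w = 0" if "\<omega> x w = 0" for w
    using c'[of w] that form_skew[of w x] form_skew[of w "K x"] by (simp add: form.scaleR_left)
  then have "k *\<^sub>R K x \<in> symp_perp \<omega> {w. \<omega> x w = 0}" by (simp add: symp_perp_def)
  then obtain d where d: "k *\<^sub>R K x = d *\<^sub>R x"
    using symp_perp_kernel reflects[OF x] by (auto simp: mem_real_line)
  then have "k *\<^sub>R K x = d *\<^sub>R (\<alpha> *\<^sub>R K x + \<beta> *\<^sub>R polar x)" using ab by metis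
  then have dP: "(d * \<beta>) *\<^sub>R polar x = (k - d * \<alpha>) *\<^sub>R K x" by (simp add: algebra_simps)
  have "d = 0"
  proof (rule ccontr)
    assume "d \<noteq> 0"
    then have "d * \<beta> \<noteq> 0" using b0 by simp
    moreover from this have "k - d * \<alpha> \<noteq> 0" using dP polar_nonzero[OF x] by auto
    ultimately have "real_line (polar x) = real_line (K x)" using dP real_line_scale by metis
    then show False using foot_ne_polar[OF x] by blast
  qed
  then have "k = 0" using d foot_nonzero[OF x] by simp
  then have "foot_coeff x = 0 \<or> foot_coeff x = \<alpha>" using a0 by (auto simp: k_def)
  then show ?thesis using foot_coeff_coordinates[OF x ab] b0 form_J_pos[OF foot_nonzero[OF x]] by auto
qed

text \<open>Where \<open>foot_coeff\<close> vanishes, the point \<open>x\<close> of the characteristic line is determined by \<open>K x\<close> up to a factor,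
  so that the kernel of the derivative of \<open>K\<close>, which is not trivial, is spanned by \<open>x\<close>.\<close>

lemma stationary_imp_foot_constant:
  assumes M': "open M'" "M' \<subseteq> M" "x \<in> M'" and s0: "\<And>y. y \<in> M' \<Longrightarrow> foot_coeff y = 0"
  shows "dK x x = 0"
proof -
  have x: "x \<in> M" using M' by blast
  \<comment> \<open>The part of the polar vector that is \<open>g_J\<close>-orthogonal to the foot,
    as a function of the foot alone. A vanishing \<open>foot_coeff\<close> makes the point a
    multiple of it.\<close>
  define E where "E = (\<lambda>k. sgrad F k - (\<omega> (sgrad F k) (J k) / \<omega> k (J k)) *\<^sub>R k)"
  define Y where "Y = (\<lambda>y. E (K y))"
  define b where "b = (\<lambda>y. (y \<bullet> Y y) / (Y y \<bullet> Y y))"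
  have Y: "y = b y *\<^sub>R Y y \<and> Y y \<noteq> 0" if "y \<in> M'" for y
  proof -
    have y: "y \<in> M" using that M' by blast
    obtain \<alpha> \<beta> where ab: "y = \<alpha> *\<^sub>R K y + \<beta> *\<^sub>R polar y" using on_characteristic[OF y] by blast
    have "\<alpha> = - (\<beta> * \<omega> (polar y) (J (K y)) / \<omega> (K y) (J (K y)))"
      using foot_coeff_coordinates[OF y ab] s0[OF that] by simp
    then have "\<alpha> *\<^sub>R K y + \<beta> *\<^sub>R polar y = \<beta> *\<^sub>R Y y"
      by (simp add: Y_def E_def scaleR_diff_right)
    then have yY: "y = \<beta> *\<^sub>R Y y" using ab by simp
    moreover have "y \<noteq> 0" using reflects[OF y] by blast
    ultimately have Y0: "Y y \<noteq> 0" by auto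
    have "b y = \<beta> * (Y y \<bullet> Y y) / (Y y \<bullet> Y y)" unfolding b_def using yY by (metis inner_scaleR_left)
    then show ?thesis using Y0 yY by simp
  qed
  have k0: "\<omega> (K x) (J (K x)) \<noteq> 0" using form_J_pos[OF foot_nonzero[OF x]] by simp
  obtain p' where p': "(sgrad F has_derivative p') (at (K x))"
    using sgrad_has_derivative[OF equation] foot_on_table[OF x] by blast
  note Jd = J.has_derivative[OF has_derivative_ident]
  obtain E' where E': "(E has_derivative E') (at (K x))"
    unfolding E_def
    using has_derivative_diff[OF p' has_derivative_scaleR[OF has_derivative_divide[OF
          form.FDERIV[OF p' Jd] form.FDERIV[OF has_derivative_ident Jd] k0] has_derivative_ident]] by blast
  have Yd: "(Y has_derivative (\<lambda>w. E' (dK x w))) (at x)"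
    unfolding Y_def by (rule has_derivative_compose[OF foot_derivative[OF x] E'])
  obtain b' where b': "(b has_derivative b') (at x)"
    unfolding b_def
    using has_derivative_divide[OF has_derivative_inner[OF has_derivative_ident Yd] has_derivative_inner[OF Yd Yd]]
      Y[OF M'(3)] by auto
  have "((\<lambda>y. b y *\<^sub>R Y y) has_derivative (\<lambda>w. b x *\<^sub>R E' (dK x w) + b' w *\<^sub>R Y x)) (at x)"
    by (rule has_derivative_scaleR[OF b' Yd])
  then have "((\<lambda>y. y) has_derivative (\<lambda>w. b x *\<^sub>R E' (dK x w) + b' w *\<^sub>R Y x)) (at x)"
    by (rule has_derivative_transform_within_open[OF _ M'(1,3)]) (use Y in metis)
  then have id: "(\<lambda>w. w) = (\<lambda>w. b x *\<^sub>R E' (dK x w) + b' w *\<^sub>R Y x)"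
    by (rule has_derivative_unique[OF has_derivative_ident])
  have linL: "linear (dK x)" using foot_derivative[OF x] by (rule has_derivative_linear)
  have "\<not> surj (dK x)"
  proof
    assume "surj (dK x)"
    then have "\<omega> (polar x) w = 0" for w using form_polar_foot_derivative[OF x] by (metis surjD)
    then show False using form_nondegenerate polar_nonzero[OF x] by blast
  qed
  then obtain w where w: "w \<noteq> 0" "dK x w = 0"
    using linear_injective_imp_surjective[OF linL] linear_injective_0[OF linL] by blast
  \<comment> \<open>On the kernel of \<open>dK x\<close> only the term with \<open>b'\<close>
    survives in the differentiated identity \<open>y = b y *\<^sub>R Y y\<close>, so
    \<open>w\<close> is parallel to \<open>x\<close>.\<close>
  have "E' (dK x w) = 0" using w(2) linear_0[OF has_derivative_linear[OF E']] by simp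
  then have "w = b' w *\<^sub>R Y x" using fun_cong[OF id, of w] by simp
  moreover from this have "b' w \<noteq> 0" using w(1) by auto
  ultimately have "Y x = inverse (b' w) *\<^sub>R w" by (metis scaleR_scaleR left_inverse scaleR_one)
  then have "x = (b x * inverse (b' w)) *\<^sub>R w" using Y[OF M'(3)] by (metis scaleR_scaleR)
  then show ?thesis using w(2) linear_scale[OF linL] by (metis scaleR_zero_right)
qed

text \<open>A second lift of the same feet, to be played off against \<open>K\<close> in
  \<open>not_stationary\<close>.\<close>

lemma rescaled_foot: "reflection_lift \<omega> J \<Sigma> N F M (\<lambda>x. (x \<bullet> x) *\<^sub>R K x) \<phi>"
proof
  \<comment> \<open>The symplectic gradient inherits degree -1 from the derivative.\<close>
  have sg: "sgrad F ((x \<bullet> x) *\<^sub>R K x) = inverse (x \<bullet> x) *\<^sub>R polar x" if "x \<in> M" for x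
  proof -
    have r: "x \<bullet> x \<noteq> 0" using reflects[OF that] by simp
    have k: "K x \<in> N" using foot_on_table[OF that] by blast
    have rk: "(x \<bullet> x) *\<^sub>R K x \<in> N" using equation k r unfolding cone_equation_def by blast
    have "\<omega> (sgrad F ((x \<bullet> x) *\<^sub>R K x) - inverse (x \<bullet> x) *\<^sub>R polar x) w = 0" for w
      using cone_equation_scale[OF equation k r, of "inverse (x \<bullet> x) *\<^sub>R w"] r
        linear_scale[OF cone_equation_linear[OF equation k]]
      by (simp add: form_sgrad[OF equation rk] form_sgrad[OF equation k] form.diff_left form.scaleR_left)
    then have "sgrad F ((x \<bullet> x) *\<^sub>R K x) - inverse (x \<bullet> x) *\<^sub>R polar x = 0" by (rule form_nondegenerate)
    then show ?thesis by simp
  qed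
  fix x assume x: "x \<in> M"
  then have r: "x \<bullet> x \<noteq> 0" using reflects by simp
  show "(\<lambda>x. (x \<bullet> x) *\<^sub>R K x) differentiable (at x)"
    using foot_differentiable[OF x] by (intro derivative_intros) auto
  show "(x \<bullet> x) *\<^sub>R K x \<in> N \<and> F ((x \<bullet> x) *\<^sub>R K x) = 0"
    using foot_on_table[OF x] equation r unfolding cone_equation_def by metis
  show "real_line (sgrad F ((x \<bullet> x) *\<^sub>R K x)) \<noteq> real_line ((x \<bullet> x) *\<^sub>R K x)"
    using foot_ne_polar[OF x] r by (simp add: sg[OF x] real_line_scale)
  show "\<exists>\<alpha> \<beta>. x = \<alpha> *\<^sub>R (x \<bullet> x) *\<^sub>R K x + \<beta> *\<^sub>R sgrad F ((x \<bullet> x) *\<^sub>R K x)"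
  proof -
    obtain \<alpha> \<beta> where ab: "x = \<alpha> *\<^sub>R K x + \<beta> *\<^sub>R polar x" using on_characteristic[OF x] by blast
    have "(\<alpha> * inverse (x \<bullet> x)) *\<^sub>R (x \<bullet> x) *\<^sub>R K x + (\<beta> * (x \<bullet> x)) *\<^sub>R sgrad F ((x \<bullet> x) *\<^sub>R K x)
      = \<alpha> *\<^sub>R K x + \<beta> *\<^sub>R polar x"
      unfolding sg[OF x] using r by (simp add: mult.assoc)
    then show ?thesis using ab by metis
  qed
  show "x \<noteq> 0 \<and> \<phi> (real_line x) = real_line (line_reflection (g_J \<omega> J) ((x \<bullet> x) *\<^sub>R K x) x)"
    using reflects[OF x] line_reflection_scale[OF r] by simp
qed (use equation open_dom in auto)

text \<open>Stationarity annihilates the derivatives of both lifts \<open>K\<close> and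
  \<open>(x \<bullet> x) K\<close> in the direction \<open>x\<close>. The product rule adds
  \<open>2 (x \<bullet> x) K x\<close>, which is nonzero, so both cannot vanish.\<close>

lemma not_stationary:
  assumes M': "open M'" "M' \<subseteq> M" "x \<in> M'" and s0: "\<And>y. y \<in> M' \<Longrightarrow> foot_coeff y = 0"
  shows False
proof -
  interpret r: reflection_lift \<omega> J \<Sigma> N F M "\<lambda>x. (x \<bullet> x) *\<^sub>R K x" \<phi> by (rule rescaled_foot)
  have x: "x \<in> M" using M' by blast
  have "r.foot_coeff y = 0" if "y \<in> M'" for y
    using s0[OF that] by (auto simp: foot_coeff_def r.foot_coeff_def J.scaleR form.scaleR_left form.scaleR_right)
  then have "r.dK x x = 0" by (rule r.stationary_imp_foot_constant[OF M'])
  have "((\<lambda>x. (x \<bullet> x) *\<^sub>R K x) has_derivative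
      (\<lambda>w. (x \<bullet> x) *\<^sub>R dK x w + (x \<bullet> w + w \<bullet> x) *\<^sub>R K x)) (at x)"
    by (intro has_derivative_scaleR has_derivative_inner has_derivative_ident foot_derivative[OF x])
  from fun_cong[OF frechet_derivative_at[OF this], of x] \<open>r.dK x x = 0\<close>
  have "(x \<bullet> x) *\<^sub>R dK x x + (x \<bullet> x + x \<bullet> x) *\<^sub>R K x = 0" by simp
  then show False
    using stationary_imp_foot_constant[OF M' s0] foot_nonzero[OF x] reflects[OF x] by simp
qed

text \<open>Non-orthogonality at \<open>x\<close> persists nearby by continuity. The alternative for
  contact reflections then makes \<open>foot_coeff\<close> vanish on an open set, which
  \<open>not_stationary\<close> excludes.\<close>

lemma contact_imp_orthogonal:
  assumes M': "open M'" "M' \<subseteq> M" "x \<in> M'"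
    and H: "\<And>y. y \<in> M' \<Longrightarrow> (H has_derivative H' y) (at y)"
    and lift: "\<And>y. y \<in> M' \<Longrightarrow> H y \<noteq> 0 \<and> \<phi> (real_line y) = real_line (H y)"
    and contact: "\<And>y w. y \<in> M' \<Longrightarrow> \<omega> (H' y w) (H y) = 0 \<longleftrightarrow> \<omega> w y = 0"
  shows "\<omega> (polar x) (J (K x)) = 0"
proof (rule ccontr)
  define q where "q = (\<lambda>y. \<omega> (polar y) (J (K y)))"
  assume "\<omega> (polar x) (J (K x)) \<noteq> 0"
  then have q0: "q x \<noteq> 0" by (simp add: q_def)
  have x: "x \<in> M" using M' by blast
  obtain p' where "(sgrad F has_derivative p') (at (K x))"
    using sgrad_has_derivative[OF equation] foot_on_table[OF x] by blast
  from has_derivative_compose[OF foot_derivative[OF x] this] have "isCont polar x"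
    by (rule has_derivative_continuous)
  moreover have "isCont (\<lambda>y. J (K y)) x"
    by (rule has_derivative_continuous[OF J.has_derivative[OF foot_derivative[OF x]]])
  ultimately have "isCont q x" unfolding q_def by (rule form.isCont)
  then have "\<forall>\<^sub>F y in at x. q y \<noteq> 0" using q0 by (auto simp: isCont_def intro: tendsto_imp_eventually_ne)
  then have "\<forall>\<^sub>F y in nhds x. q y \<noteq> 0" using q0 by (simp add: eventually_nhds_conv_at)
  then obtain M'' where M'': "open M''" "x \<in> M''" "\<And>y. y \<in> M'' \<Longrightarrow> q y \<noteq> 0" unfolding eventually_nhds by blast
  have "foot_coeff y = 0" if "y \<in> M' \<inter> M''" for y
  proof -
    have y: "y \<in> M'" "y \<in> M" "y \<in> M''" using that M' by auto
    show ?thesis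
      using contact_imp_stationary_or_orthogonal[OF y(2) M'(1) y(1) H[OF y(1)] lift contact[OF y(1)]]
        M''(3)[OF y(3)] by (auto simp: q_def)
  qed
  then show False using not_stationary[of "M' \<inter> M''" x] M' M'' by auto
qed

end

section \<open>Passage between the angle rule and its lifts\<close>

context compatible_symplectic
begin

text \<open>The domain is shrunk so that a single local equation serves all the points \<open>K x\<close>.\<close>

lemma reflection_lift_exists:
  assumes tab: "table \<Sigma>"
    and dl: "defines_local_diffeo (angle_rule \<omega> (g_J \<omega> J) \<Sigma>) U \<kappa> \<phi>"
    and v: "v \<in> cone_over real_line U"
  obtains N F M K where "reflection_lift \<omega> J \<Sigma> N F M K \<phi>" "v \<in> M" "M \<subseteq> cone_over real_line U"
    and "\<And>x. x \<in> M \<Longrightarrow> \<kappa> (real_line x) = real_line (K x)"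
    and "\<And>x. x \<in> N \<Longrightarrow> F x = 0 \<Longrightarrow> tangent_hyperplane \<Sigma> (real_line x) = {w. \<omega> (sgrad F x) w = 0}"
proof -
  obtain N0 K where v0: "v \<in> N0" and lift: "local_lift \<kappa> U N0 K"
    using dl v unfolding defines_local_diffeo_def proj_smooth_on_def by blast
  have N0: "open N0" "N0 \<subseteq> cone_over real_line U" "\<And>k. Ck_on k N0 K"
    "\<And>x. x \<in> N0 \<Longrightarrow> K x \<noteq> 0 \<and> \<kappa> (real_line x) = real_line (K x)"
    using lift unfolding local_lift_def smooth_on_def by blast+
  have rule: "angle_rule \<omega> (g_J \<omega> J) \<Sigma> (real_line (K x)) (real_line x) (\<phi> (real_line x))" if "x \<in> N0" for x
  proof -
    have "real_line x \<in> U" using N0(2) that by (auto simp: cone_over_def)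
    then show ?thesis using dl N0(4)[OF that] unfolding defines_local_diffeo_def by metis
  qed
  have table: "real_line (K x) \<in> \<Sigma>" if "x \<in> N0" for x
    using rule[OF that] unfolding angle_rule_def by blast
  obtain N F where ce: "cone_equation \<Sigma> N F" "K v \<in> N"
    and T: "\<And>x. x \<in> N \<Longrightarrow> F x = 0 \<Longrightarrow> tangent_hyperplane \<Sigma> (real_line x) = {w. \<omega> (sgrad F x) w = 0}"
    and P: "\<And>x. x \<in> N \<Longrightarrow> F x = 0 \<Longrightarrow> polar_point \<omega> \<Sigma> (real_line x) = real_line (sgrad F x)"
    using table_sgrad[OF tab, of "K v"] N0(4)[OF v0] table[OF v0] by metis
  define M where "M = N0 \<inter> K -` N"
  have "open M"
    unfolding M_def using N0(3)[of 0] N0(1) ce(1) unfolding cone_equation_def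
    by (intro continuous_open_preimage) auto
  have "reflection_lift \<omega> J \<Sigma> N F M K \<phi>"
  proof
    show "cone_equation \<Sigma> N F" "open M" by fact+
    fix x assume "x \<in> M"
    then have x: "x \<in> N0" "K x \<in> N" by (auto simp: M_def)
    have x0: "x \<noteq> 0" using x N0(2) by (auto simp: cone_over_def)
    show "K differentiable (at x)" using N0(3)[of "Suc 0"] x by simp
    show "K x \<in> N \<and> F (K x) = 0" using x table[OF x(1)] ce(1) unfolding cone_equation_def by blast
    then have p: "polar_point \<omega> \<Sigma> (real_line (K x)) = real_line (sgrad F (K x))" using P by blast
    note iff = angle_rule_iff[OF conjunct1[OF N0(4)[OF x(1)]] table[OF x(1)] p]
    obtain \<alpha> \<beta> where ne: "real_line (sgrad F (K x)) \<noteq> real_line (K x)"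
      and Z: "real_line x = real_line (\<alpha> *\<^sub>R K x + \<beta> *\<^sub>R sgrad F (K x))"
      and Z': "\<phi> (real_line x) = real_line (line_reflection (g_J \<omega> J) (K x) (\<alpha> *\<^sub>R K x + \<beta> *\<^sub>R sgrad F (K x)))"
      using rule[OF x(1)] unfolding iff by blast
    show "real_line (sgrad F (K x)) \<noteq> real_line (K x)" by (rule ne)
    \<comment> \<open>The rule compares lines, so its vector in the characteristic plane agrees with
      \<open>x\<close> only up to the factor \<open>c\<close>, with which the reflection
      commutes.\<close>
    obtain c where c: "x = c *\<^sub>R (\<alpha> *\<^sub>R K x + \<beta> *\<^sub>R sgrad F (K x))" using Z real_line_eqD by metis
    then have "c \<noteq> 0" using x0 by auto
    have "c *\<^sub>R (\<alpha> *\<^sub>R K x + \<beta> *\<^sub>R sgrad F (K x)) = (c * \<alpha>) *\<^sub>R K x + (c * \<beta>) *\<^sub>R sgrad F (K x)"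
      by (simp add: scaleR_add_right)
    then show "\<exists>\<alpha> \<beta>. x = \<alpha> *\<^sub>R K x + \<beta> *\<^sub>R sgrad F (K x)" using c by metis
    have "line_reflection (g_J \<omega> J) (K x) (c *\<^sub>R z) = c *\<^sub>R line_reflection (g_J \<omega> J) (K x) z" for z
      by (simp add: line_reflection_def g_J_def form.scaleR_left scaleR_diff_right mult_ac)
    then show "x \<noteq> 0 \<and> \<phi> (real_line x) = real_line (line_reflection (g_J \<omega> J) (K x) x)"
      using x0 Z' c real_line_scale[OF \<open>c \<noteq> 0\<close>] by metis
  qed
  then show thesis
    using that[of N F M K] v0 ce(2) N0 T by (auto simp: M_def)
qed

lemma tangent_J_imp_contact:
  assumes tab: "table \<Sigma>" and tJ: "tangent_J \<Sigma>"
  shows "generates_contact_transformation \<omega> (angle_rule \<omega> (g_J \<omega> J) \<Sigma>)"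
  unfolding generates_contact_transformation_def preserves_contact_def
proof (intro allI impI ballI)
  fix U \<kappa> \<phi> M' H v w
  assume dl: "defines_local_diffeo (angle_rule \<omega> (g_J \<omega> J) \<Sigma>) U \<kappa> \<phi>"
    and lift: "local_lift \<phi> U M' H" and v: "v \<in> M'"
  have M': "open M'" "M' \<subseteq> cone_over real_line U" "Ck_on (Suc 0) M' H"
    "\<And>x. x \<in> M' \<Longrightarrow> H x \<noteq> 0 \<and> \<phi> (real_line x) = real_line (H x)"
    using lift unfolding local_lift_def smooth_on_def by blast+
  have vU: "v \<in> cone_over real_line U" using M'(2) v by blast
  obtain N F M K where rl: "reflection_lift \<omega> J \<Sigma> N F M K \<phi>" and vM: "v \<in> M"
    and T: "\<And>x. x \<in> N \<Longrightarrow> F x = 0 \<Longrightarrow> tangent_hyperplane \<Sigma> (real_line x) = {w. \<omega> (sgrad F x) w = 0}"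
    by (rule reflection_lift_exists[OF tab dl vU]) (rule that; assumption)
  interpret reflection_lift \<omega> J \<Sigma> N F M K \<phi> by (rule rl)
  have "K v \<in> N" "F (K v) = 0" using foot_on_table[OF vM] by auto
  moreover from this have "real_line (K v) \<in> \<Sigma>" using equation unfolding cone_equation_def by blast
  ultimately have "\<omega> (polar v) (J (K v)) = 0"
    using tJ foot_nonzero[OF vM] T unfolding tangent_J_def by blast
  from tangent_preserves_contact[OF vM this M'(1) v Ck_on_has_derivative[OF M'(3) v] M'(4)]
  show "w \<in> contact_hyperplane \<omega> (real_line v) \<longleftrightarrow>
      frechet_derivative H (at v) w \<in> contact_hyperplane \<omega> (\<phi> (real_line v))"
    using M'(4)[OF v] by (simp add: contact_hyperplane_real_line)
qed

lemma contact_imp_orthogonal_foot: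
  assumes tab: "table \<Sigma>"
    and gen: "generates_contact_transformation \<omega> (angle_rule \<omega> (g_J \<omega> J) \<Sigma>)"
    and dl: "defines_local_diffeo (angle_rule \<omega> (g_J \<omega> J) \<Sigma>) U \<kappa> \<phi>" and Z: "Z \<in> U"
  shows "\<exists>k. k \<noteq> 0 \<and> \<kappa> Z = real_line k \<and> real_line k \<in> \<Sigma> \<and> J k \<in> tangent_hyperplane \<Sigma> (real_line k)"
proof -
  obtain v where v: "Z = real_line v" "v \<noteq> 0"
    using dl Z unfolding defines_local_diffeo_def proj_diffeo_on_def quot_open_def quot_space_def by blast
  have vU: "v \<in> cone_over real_line U" using v Z by (simp add: cone_over_def)
  obtain M0 H where lift: "local_lift \<phi> U M0 H" and vM0: "v \<in> M0"
    using dl vU unfolding defines_local_diffeo_def proj_diffeo_on_def proj_smooth_on_def by blast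
  have M0: "open M0" "M0 \<subseteq> cone_over real_line U" "Ck_on (Suc 0) M0 H"
    "\<And>x. x \<in> M0 \<Longrightarrow> H x \<noteq> 0 \<and> \<phi> (real_line x) = real_line (H x)"
    using lift unfolding local_lift_def smooth_on_def by blast+
  obtain N F M K where rl: "reflection_lift \<omega> J \<Sigma> N F M K \<phi>" and vM: "v \<in> M"
    and K: "\<And>x. x \<in> M \<Longrightarrow> \<kappa> (real_line x) = real_line (K x)"
    and T: "\<And>x. x \<in> N \<Longrightarrow> F x = 0 \<Longrightarrow> tangent_hyperplane \<Sigma> (real_line x) = {w. \<omega> (sgrad F x) w = 0}"
    by (rule reflection_lift_exists[OF tab dl vU]) (rule that; assumption)
  interpret reflection_lift \<omega> J \<Sigma> N F M K \<phi> by (rule rl)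
  have pc: "preserves_contact \<omega> U \<phi>" using gen dl unfolding generates_contact_transformation_def by blast
  have "\<omega> (polar v) (J (K v)) = 0"
  proof (rule contact_imp_orthogonal[of "M \<inter> M0" v H "\<lambda>y. frechet_derivative H (at y)"])
    show "\<omega> (frechet_derivative H (at y) w) (H y) = 0 \<longleftrightarrow> \<omega> w y = 0" if y: "y \<in> M \<inter> M0" for y w
    proof -
      have "y \<in> M0" using y by blast
      then have "w \<in> contact_hyperplane \<omega> (real_line y) \<longleftrightarrow>
          frechet_derivative H (at y) w \<in> contact_hyperplane \<omega> (\<phi> (real_line y))"
        using pc lift unfolding preserves_contact_def by blast
      then show ?thesis using M0(4)[OF \<open>y \<in> M0\<close>] by (simp add: contact_hyperplane_real_line)
    qed
  qed (use open_dom M0 vM vM0 in \<open>auto simp del: Ck_on.simps intro: Ck_on_has_derivative\<close>)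
  moreover have k: "K v \<in> N" "F (K v) = 0" using foot_on_table[OF vM] by auto
  moreover from this have "real_line (K v) \<in> \<Sigma>" using equation unfolding cone_equation_def by blast
  ultimately show ?thesis
    using K[OF vM] v foot_nonzero[OF vM] T[OF k] by (intro exI[of _ "K v"]) auto
qed

text \<open>Contact gives tangency only at the feet of local diffeomorphisms. The set where
  \<open>q\<close> is nonzero is open and invariant under scaling, so it descends to projective
  space. If it met the table, density would place such a foot in it.\<close>

lemma contact_imp_tangent_J:
  assumes tab: "table \<Sigma>"
    and dense: "defines_local_diffeos_densely \<Sigma> (angle_rule \<omega> (g_J \<omega> J) \<Sigma>)"
    and gen: "generates_contact_transformation \<omega> (angle_rule \<omega> (g_J \<omega> J) \<Sigma>)"
  shows "tangent_J \<Sigma>"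
  unfolding tangent_J_def
proof (intro allI impI)
  fix v :: 'a assume v: "v \<noteq> 0" "real_line v \<in> \<Sigma>"
  obtain N F where ce: "cone_equation \<Sigma> N F" "v \<in> N" "F v = 0"
    and T: "\<And>x. x \<in> N \<Longrightarrow> F x = 0 \<Longrightarrow> tangent_hyperplane \<Sigma> (real_line x) = {w. \<omega> (sgrad F x) w = 0}"
    using table_sgrad[OF tab v] by metis
  have oN: "open N" and Ns: "\<And>x t. x \<in> N \<Longrightarrow> t \<noteq> 0 \<Longrightarrow> t *\<^sub>R x \<in> N" and N0: "0 \<notin> N"
    and F_iff: "\<And>x. x \<in> N \<Longrightarrow> real_line x \<in> \<Sigma> \<longleftrightarrow> F x = 0"
    using ce(1) unfolding cone_equation_def by blast+
  define q where "q = (\<lambda>y. \<omega> (sgrad F y) (J y))"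
  have contq: "isCont q y" if "y \<in> N" for y
  proof -
    have "isCont (sgrad F) y" using sgrad_has_derivative[OF ce(1) that] has_derivative_continuous by blast
    then show ?thesis
      unfolding q_def by (intro form.isCont J.isCont continuous_ident)
  qed
  have qs: "q (t *\<^sub>R y) = q y" if y: "y \<in> N" and t: "t \<noteq> 0" for y t
    using form_sgrad[OF ce(1) Ns[OF y t]] form_sgrad[OF ce(1) y] cone_equation_scale[OF ce(1) y t]
    by (simp add: q_def J.scaleR)
  have "q v = 0"
  proof (rule ccontr)
    assume q0: "q v \<noteq> 0"
    define C where "C = N \<inter> q -` (- {0})"
    have "continuous_on N q" using contq by (simp add: continuous_at_imp_continuous_on)
    then have oC: "open C" unfolding C_def using oN by (intro continuous_open_preimage) auto
    have C0: "x \<noteq> 0" if "x \<in> C" for x using that N0 by (auto simp: C_def)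
    define W where "W = real_line ` C"
    have CW: "x \<in> C" if x: "x \<noteq> 0" "real_line x \<in> W" for x
    proof -
      obtain y where y: "y \<in> C" "real_line y = real_line x" using x unfolding W_def by auto
      then obtain c where c: "x = c *\<^sub>R y" using real_line_eqD by blast
      then have "c \<noteq> 0" using x by auto
      then show ?thesis using y(1) Ns qs by (auto simp: C_def c)
    qed
    have "cone_over real_line W = C" using CW C0 by (auto simp: cone_over_def W_def)
    then have "quot_open real_line W"
      unfolding quot_open_def using oC C0 by (auto simp: W_def quot_space_def)
    moreover have "real_line v \<in> W" using ce(2) q0 by (auto simp: W_def C_def)
    ultimately obtain U \<kappa> \<phi> Z where dl: "defines_local_diffeo (angle_rule \<omega> (g_J \<omega> J) \<Sigma>) U \<kappa> \<phi>"
      and Z: "Z \<in> U" "\<kappa> Z \<in> W"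
      using dense v(2) unfolding defines_local_diffeos_densely_def by blast
    obtain k where k: "k \<noteq> 0" "\<kappa> Z = real_line k" "real_line k \<in> \<Sigma>" "J k \<in> tangent_hyperplane \<Sigma> (real_line k)"
      using contact_imp_orthogonal_foot[OF tab gen dl Z(1)] by blast
    have "k \<in> C" using CW k Z(2) by simp
    then have "k \<in> N" "q k \<noteq> 0" by (auto simp: C_def)
    then show False using T[of k] F_iff k by (simp add: q_def)
  qed
  then show "J v \<in> tangent_hyperplane \<Sigma> (real_line v)" using T[OF ce(2,3)] by (simp add: q_def)
qed

end

theorem theorem5p3:
  fixes \<omega> :: "'a::euclidean_space \<Rightarrow> 'a \<Rightarrow> real"
    and J :: "'a \<Rightarrow> 'a"
    and \<Sigma> :: "'a set set"
    and n :: nat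
  assumes "DIM('a) = 2 * n" and "n \<ge> 2"
    and "symplectic_form \<omega>"
    and "compatible_complex_structure \<omega> J"
    and "table \<Sigma>"
  shows "(defines_local_diffeos_densely \<Sigma> (angle_rule \<omega> (g_J \<omega> J) \<Sigma>) \<longrightarrow>
            (generates_contact_transformation \<omega> (angle_rule \<omega> (g_J \<omega> J) \<Sigma>) \<longleftrightarrow>
             rules_coincide (angle_rule \<omega> (g_J \<omega> J) \<Sigma>) (outer_rule \<omega> \<Sigma>)))
       \<and> (rules_coincide (angle_rule \<omega> (g_J \<omega> J) \<Sigma>) (outer_rule \<omega> \<Sigma>) \<longleftrightarrow> hopf_table J \<Sigma>)
       \<and> (hopf_table J \<Sigma> \<longrightarrow>
            generates_contact_transformation \<omega> (angle_rule \<omega> (g_J \<omega> J) \<Sigma>))"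
proof -
  interpret compatible_symplectic \<omega> J using assms(3,4) by unfold_locales
  \<comment> \<open>From three dimensions on, the kernel of \<open>\<omega> v\<close> cannot be
    isotropic, which excludes integral hypersurfaces.\<close>
  have "DIM('a) \<ge> 3" using assms(1,2) by simp
  then have rules: "rules_coincide (angle_rule \<omega> (g_J \<omega> J) \<Sigma>) (outer_rule \<omega> \<Sigma>) \<longleftrightarrow> tangent_J \<Sigma>"
    using rules_coincide_imp_tangent_J tangent_J_imp_rules_coincide assms(5) by blast
  moreover have "hopf_table J \<Sigma> \<longleftrightarrow> tangent_J \<Sigma>"
    using hopf_table_imp_tangent_J tangent_J_imp_hopf_table assms(5) by blast
  moreover have "tangent_J \<Sigma> \<Longrightarrow> generates_contact_transformation \<omega> (angle_rule \<omega> (g_J \<omega> J) \<Sigma>)"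
    using tangent_J_imp_contact assms(5) by blast
  moreover have "tangent_J \<Sigma>"
    if "defines_local_diffeos_densely \<Sigma> (angle_rule \<omega> (g_J \<omega> J) \<Sigma>)"
      "generates_contact_transformation \<omega> (angle_rule \<omega> (g_J \<omega> J) \<Sigma>)"
    using contact_imp_tangent_J assms(5) that by blast
  ultimately show ?thesis by blast
qed

end
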